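(* Assume that ${\sf C}$ is symmetric. Then the category ${\sf HBrcd}$ of Hopf bracoids in ${\sf C}$ is a symmetric monoidal category with base (unit) object $(K,K,id_{K})$, tensor functor $\otimes\colon{\sf HBrcd}\times{\sf HBrcd}\to{\sf HBrcd}$ given on objects by $$((H,B,\varphi_{B}),(A,D,\varphi_{D}))\longmapsto(H\otimes A,B\otimes D,\varphi_{B\otimes D}),\qquad \varphi_{B\otimes D}= (\varphi_{B}\otimes\varphi_{D})\circ(H\otimes c_{A,B}\otimes D),$$ and symmetry isomorphism $$c_{(H,B,\varphi_{B}),(A,D,\varphi_{D})}=(c_{H,A},c_{B,D})\colon(H\otimes A,B\otimes D,\varphi_{B\otimes D})\longrightarrow (A\otimes H,D\otimes B,\varphi_{D\otimes B})$$ for all Hopf bracoids $(H,B,\varphi_{B})$ and $(A,D,\varphi_{D})$.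
   Context: ${\sf C}$ is a strict braided monoidal category with tensor product $\otimes$, unit object $K$ and braiding $c$; it is symmetric if $c_{N,M}\circ c_{M,N}=id_{M\otimes N}$ for all $M,N$. For an object $P$ and a morphism $f$, write $P\otimes f$ for $id_P\otimes f$ and $f\otimes P$ for $f\otimes id_P$. Algebras $(A,\eta_A,\mu_A)$, coalgebras $(D,\varepsilon_D,\delta_D)$, and Hopf algebras $X=(X,\eta_X,\mu_X,\varepsilon_X,\delta_X,\lambda_X)$ (with antipode $\lambda_X$) are taken in ${\sf C}$; tensor products have structures $\mu_{A\otimes B}=(\mu_A\otimes\mu_B)\circ(A\otimes c_{B,A}\otimes B)$ and $\delta_{D\otimes E}=(D\otimes c_{D,E}\otimes E)\circ(\delta_D\otimes\delta_E)$, with the obvious units and counits; when ${\sf C}$ is symmetric the tensor product $H\otimes A$ of Hopf algebras is a Hopf algebra with antipode $\lambda_H\otimes\lambda_A$. A morphism of Hopf algebras is a morphism that is both an algebra and a coalgebra morphism. A Hopf bracoid in ${\sf C}$ is a triple $(H,B,\varphi_B)$ where $H,B$ are Hopf algebras in ${\sf C}$ and $(B,\varphi_B)$ is a left $H$-module such that $$\varphi_{B}\circ(H\otimes\mu_{B})=\mu_{B}\circ (\varphi_{B}\otimes\Phi_{B})\circ(H\otimes c_{H,B}\otimes B)\circ(\delta_{H}\otimes B\otimes B),$$ where $\Phi_{B}= \mu_{B}\circ((\lambda_{B}\circ u_{\varphi_{B}})\otimes\varphi_{B})\circ(\delta_{H}\otimes B)$ and $u_{\varphi_{B}}=\varphi_{B}\circ(H\otimes\eta_{B})$.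 A morphism of Hopf bracoids $(H,B,\varphi_B)\to(H',B',\varphi_{B'})$ is a pair $(f,g)$ of Hopf algebra morphisms $f\colon H\to H'$, $g\colon B\to B'$ with $g\circ\varphi_B=\varphi_{B'}\circ(f\otimes g)$. These form the category ${\sf HBrcd}$. The tensor functor acts on morphisms componentwise: $(f,g)\otimes(f',g')=(f\otimes f',g\otimes g')$. *)

theory Defs
  imports Main
begin

section \<open>Categories\<close>

text \<open>
  Hom-sets are indexed by their end points and need not be disjoint, so that the morphisms of a
  category of structured objects can be taken to be the plain underlying morphisms. Composition,
  identities and the tensor product are only constrained on objects and on typed morphisms.
\<close>

record ('o, 'm) cat =
  Obj :: "'o set"
  Hom :: "'o \<Rightarrow> 'o \<Rightarrow> 'm set"
  Id :: "'o \<Rightarrow> 'm" ("\<iota>\<index>")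
  Comp :: "'m \<Rightarrow> 'm \<Rightarrow> 'm" (infixr "\<cdot>\<index>" 60)

locale category =
  fixes C :: "('o, 'm, 'x) cat_scheme" (structure)
  assumes Id_Hom: "A \<in> Obj C \<Longrightarrow> \<iota> A \<in> Hom C A A"
    and Comp_Hom: "\<lbrakk>P \<in> Obj C; Q \<in> Obj C; R \<in> Obj C; f \<in> Hom C P Q; g \<in> Hom C Q R\<rbrakk>
      \<Longrightarrow> g \<cdot> f \<in> Hom C P R"
    and Id_left: "\<lbrakk>P \<in> Obj C; Q \<in> Obj C; f \<in> Hom C P Q\<rbrakk> \<Longrightarrow> \<iota> Q \<cdot> f = f"
    and Id_right: "\<lbrakk>P \<in> Obj C; Q \<in> Obj C; f \<in> Hom C P Q\<rbrakk> \<Longrightarrow> f \<cdot> \<iota> P = f"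
    and Comp_assoc: "\<lbrakk>P \<in> Obj C; Q \<in> Obj C; R \<in> Obj C; S \<in> Obj C;
        f \<in> Hom C P Q; g \<in> Hom C Q R; h \<in> Hom C R S\<rbrakk>
      \<Longrightarrow> (h \<cdot> g) \<cdot> f = h \<cdot> (g \<cdot> f)"

definition inverse_arrows ::
  "('o, 'm, 'x) cat_scheme \<Rightarrow> 'o \<Rightarrow> 'o \<Rightarrow> 'm \<Rightarrow> 'm \<Rightarrow> bool" where
  "inverse_arrows C P Q f g \<longleftrightarrow>
     f \<in> Hom C P Q \<and> g \<in> Hom C Q P \<and> g \<cdot>\<^bsub>C\<^esub> f = \<iota>\<^bsub>C\<^esub> P \<and> f \<cdot>\<^bsub>C\<^esub> g = \<iota>\<^bsub>C\<^esub> Q"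

definition isomorphism :: "('o, 'm, 'x) cat_scheme \<Rightarrow> 'o \<Rightarrow> 'o \<Rightarrow> 'm \<Rightarrow> bool" where
  "isomorphism C P Q f \<longleftrightarrow> (\<exists>g. inverse_arrows C P Q f g)"


section \<open>Monoidal, braided and symmetric categories\<close>

text \<open>\<open>\<otimes>\<close> is the tensor product of objects, \<open>\<boxtimes>\<close> that of morphisms.\<close>

record ('o, 'm) monoidal_cat = "('o, 'm) cat" +
  tensor_obj :: "'o \<Rightarrow> 'o \<Rightarrow> 'o" (infixr "\<otimes>\<index>" 70)
  tensor_arr :: "'m \<Rightarrow> 'm \<Rightarrow> 'm" (infixr "\<boxtimes>\<index>" 70)
  unit_obj :: "'o" ("\<K>\<index>")
  associator :: "'o \<Rightarrow> 'o \<Rightarrow> 'o \<Rightarrow> 'm" ("\<alpha>\<index>")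
  left_unitor :: "'o \<Rightarrow> 'm" ("\<ll>\<index>")
  right_unitor :: "'o \<Rightarrow> 'm" ("\<rr>\<index>")

record ('o, 'm) braided_cat = "('o, 'm) monoidal_cat" +
  braiding :: "'o \<Rightarrow> 'o \<Rightarrow> 'm" ("\<c>\<index>")

locale monoidal_category = category C
  for C :: "('o, 'm, 'x) monoidal_cat_scheme" (structure) +
  assumes unit_Obj: "\<K> \<in> Obj C"
    and tensor_Obj: "\<lbrakk>P \<in> Obj C; Q \<in> Obj C\<rbrakk> \<Longrightarrow> P \<otimes> Q \<in> Obj C"
    and tensor_Hom: "\<lbrakk>P \<in> Obj C; P' \<in> Obj C; Q \<in> Obj C; Q' \<in> Obj C;
        f \<in> Hom C P P'; g \<in> Hom C Q Q'\<rbrakk>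
      \<Longrightarrow> f \<boxtimes> g \<in> Hom C (P \<otimes> Q) (P' \<otimes> Q')"
    and tensor_Id: "\<lbrakk>P \<in> Obj C; Q \<in> Obj C\<rbrakk> \<Longrightarrow> \<iota> P \<boxtimes> \<iota> Q = \<iota> (P \<otimes> Q)"
    and tensor_Comp: "\<lbrakk>P \<in> Obj C; P' \<in> Obj C; P'' \<in> Obj C;
        Q \<in> Obj C; Q' \<in> Obj C; Q'' \<in> Obj C;
        f \<in> Hom C P P'; f' \<in> Hom C P' P''; g \<in> Hom C Q Q'; g' \<in> Hom C Q' Q''\<rbrakk>
      \<Longrightarrow> (f' \<cdot> f) \<boxtimes> (g' \<cdot> g) = (f' \<boxtimes> g') \<cdot> (f \<boxtimes> g)"
    and associator_iso: "\<lbrakk>P \<in> Obj C; Q \<in> Obj C; R \<in> Obj C\<rbrakk>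
      \<Longrightarrow> isomorphism C ((P \<otimes> Q) \<otimes> R) (P \<otimes> (Q \<otimes> R)) (\<alpha> P Q R)"
    and associator_natural: "\<lbrakk>P \<in> Obj C; P' \<in> Obj C; Q \<in> Obj C; Q' \<in> Obj C;
        R \<in> Obj C; R' \<in> Obj C; f \<in> Hom C P P'; g \<in> Hom C Q Q'; h \<in> Hom C R R'\<rbrakk>
      \<Longrightarrow> \<alpha> P' Q' R' \<cdot> ((f \<boxtimes> g) \<boxtimes> h) = (f \<boxtimes> (g \<boxtimes> h)) \<cdot> \<alpha> P Q R"
    and left_unitor_iso: "P \<in> Obj C \<Longrightarrow> isomorphism C (\<K> \<otimes> P) P (\<ll> P)"
    and left_unitor_natural: "\<lbrakk>P \<in> Obj C; Q \<in> Obj C; f \<in> Hom C P Q\<rbrakk>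
      \<Longrightarrow> \<ll> Q \<cdot> (\<iota> \<K> \<boxtimes> f) = f \<cdot> \<ll> P"
    and right_unitor_iso: "P \<in> Obj C \<Longrightarrow> isomorphism C (P \<otimes> \<K>) P (\<rr> P)"
    and right_unitor_natural: "\<lbrakk>P \<in> Obj C; Q \<in> Obj C; f \<in> Hom C P Q\<rbrakk>
      \<Longrightarrow> \<rr> Q \<cdot> (f \<boxtimes> \<iota> \<K>) = f \<cdot> \<rr> P"
    and pentagon: "\<lbrakk>P \<in> Obj C; Q \<in> Obj C; R \<in> Obj C; S \<in> Obj C\<rbrakk>
      \<Longrightarrow> \<alpha> P Q (R \<otimes> S) \<cdot> \<alpha> (P \<otimes> Q) R S
        = (\<iota> P \<boxtimes> \<alpha> Q R S) \<cdot> \<alpha> P (Q \<otimes> R) S \<cdot> (\<alpha> P Q R \<boxtimes> \<iota> S)"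
    and triangle: "\<lbrakk>P \<in> Obj C; Q \<in> Obj C\<rbrakk>
      \<Longrightarrow> (\<iota> P \<boxtimes> \<ll> Q) \<cdot> \<alpha> P \<K> Q = \<rr> P \<boxtimes> \<iota> Q"

locale strict_monoidal_category = monoidal_category C
  for C :: "('o, 'm, 'x) monoidal_cat_scheme" (structure) +
  assumes strict_assoc: "\<lbrakk>P \<in> Obj C; Q \<in> Obj C; R \<in> Obj C\<rbrakk>
      \<Longrightarrow> (P \<otimes> Q) \<otimes> R = P \<otimes> (Q \<otimes> R)"
    and strict_left_unit: "P \<in> Obj C \<Longrightarrow> \<K> \<otimes> P = P"
    and strict_right_unit: "P \<in> Obj C \<Longrightarrow> P \<otimes> \<K> = P"
    and associator_Id: "\<lbrakk>P \<in> Obj C; Q \<in> Obj C; R \<in> Obj C\<rbrakk>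
      \<Longrightarrow> \<alpha> P Q R = \<iota> (P \<otimes> (Q \<otimes> R))"
    and left_unitor_Id: "P \<in> Obj C \<Longrightarrow> \<ll> P = \<iota> P"
    and right_unitor_Id: "P \<in> Obj C \<Longrightarrow> \<rr> P = \<iota> P"

locale braided_monoidal_category = monoidal_category C
  for C :: "('o, 'm, 'x) braided_cat_scheme" (structure) +
  assumes braiding_iso: "\<lbrakk>P \<in> Obj C; Q \<in> Obj C\<rbrakk>
      \<Longrightarrow> isomorphism C (P \<otimes> Q) (Q \<otimes> P) (\<c> P Q)"
    and braiding_natural: "\<lbrakk>P \<in> Obj C; P' \<in> Obj C; Q \<in> Obj C; Q' \<in> Obj C;
        f \<in> Hom C P P'; g \<in> Hom C Q Q'\<rbrakk>
      \<Longrightarrow> \<c> P' Q' \<cdot> (f \<boxtimes> g) = (g \<boxtimes> f) \<cdot> \<c> P Q"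
    and hexagon_right: "\<lbrakk>P \<in> Obj C; Q \<in> Obj C; R \<in> Obj C\<rbrakk>
      \<Longrightarrow> \<alpha> Q R P \<cdot> \<c> P (Q \<otimes> R) \<cdot> \<alpha> P Q R
        = (\<iota> Q \<boxtimes> \<c> P R) \<cdot> \<alpha> Q P R \<cdot> (\<c> P Q \<boxtimes> \<iota> R)"
    and hexagon_left: "\<lbrakk>P \<in> Obj C; Q \<in> Obj C; R \<in> Obj C;
        inverse_arrows C ((P \<otimes> Q) \<otimes> R) (P \<otimes> (Q \<otimes> R)) (\<alpha> P Q R) a;
        inverse_arrows C ((P \<otimes> R) \<otimes> Q) (P \<otimes> (R \<otimes> Q)) (\<alpha> P R Q) a';
        inverse_arrows C ((R \<otimes> P) \<otimes> Q) (R \<otimes> (P \<otimes> Q)) (\<alpha> R P Q) a''\<rbrakk>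
      \<Longrightarrow> a'' \<cdot> \<c> (P \<otimes> Q) R \<cdot> a
        = (\<c> P R \<boxtimes> \<iota> Q) \<cdot> a' \<cdot> (\<iota> P \<boxtimes> \<c> Q R)"

locale symmetric_monoidal_category = braided_monoidal_category C
  for C :: "('o, 'm, 'x) braided_cat_scheme" (structure) +
  assumes symmetry: "\<lbrakk>P \<in> Obj C; Q \<in> Obj C\<rbrakk> \<Longrightarrow> \<c> Q P \<cdot> \<c> P Q = \<iota> (P \<otimes> Q)"


section \<open>Hopf algebras\<close>

text \<open>
  From here on the formulas make sense for a strict \<open>C\<close> only: bracketings of tensor products are
  ignored, and \<open>\<K> \<otimes> P\<close> and \<open>P \<otimes> \<K>\<close> are identified with \<open>P\<close>.
\<close>

record ('o, 'm) hopf =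
  carrier :: 'o
  unit :: 'm ("\<eta>")
  mult :: 'm ("\<mu>")
  counit :: 'm ("\<epsilon>")
  comult :: 'm ("\<delta>")
  antipode :: 'm ("\<lambda>\<^sub>S")

type_synonym ('o, 'm) bracoid = "('o, 'm) hopf \<times> ('o, 'm) hopf \<times> 'm"

context
  fixes C :: "('o, 'm, 'x) braided_cat_scheme" (structure)
begin

definition algebra :: "'o \<Rightarrow> 'm \<Rightarrow> 'm \<Rightarrow> bool" where
  "algebra A e m \<longleftrightarrow>
     A \<in> Obj C \<and> e \<in> Hom C \<K> A \<and> m \<in> Hom C (A \<otimes> A) A \<and>
     m \<cdot> (e \<boxtimes> \<iota> A) = \<iota> A \<and> m \<cdot> (\<iota> A \<boxtimes> e) = \<iota> A \<and>
     m \<cdot> (m \<boxtimes> \<iota> A) = m \<cdot> (\<iota> A \<boxtimes> m)"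

definition coalgebra :: "'o \<Rightarrow> 'm \<Rightarrow> 'm \<Rightarrow> bool" where
  "coalgebra D e d \<longleftrightarrow>
     D \<in> Obj C \<and> e \<in> Hom C D \<K> \<and> d \<in> Hom C D (D \<otimes> D) \<and>
     (e \<boxtimes> \<iota> D) \<cdot> d = \<iota> D \<and> (\<iota> D \<boxtimes> e) \<cdot> d = \<iota> D \<and>
     (d \<boxtimes> \<iota> D) \<cdot> d = (\<iota> D \<boxtimes> d) \<cdot> d"

definition algebra_morphism :: "'o \<Rightarrow> 'm \<Rightarrow> 'm \<Rightarrow> 'o \<Rightarrow> 'm \<Rightarrow> 'm \<Rightarrow> 'm \<Rightarrow> bool" where
  "algebra_morphism A e m A' e' m' f \<longleftrightarrow>
     f \<in> Hom C A A' \<and> f \<cdot> e = e' \<and> f \<cdot> m = m' \<cdot> (f \<boxtimes> f)"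

definition coalgebra_morphism :: "'o \<Rightarrow> 'm \<Rightarrow> 'm \<Rightarrow> 'o \<Rightarrow> 'm \<Rightarrow> 'm \<Rightarrow> 'm \<Rightarrow> bool" where
  "coalgebra_morphism D e d D' e' d' f \<longleftrightarrow>
     f \<in> Hom C D D' \<and> e' \<cdot> f = e \<and> d' \<cdot> f = (f \<boxtimes> f) \<cdot> d"

definition tensor_mult :: "'o \<Rightarrow> 'm \<Rightarrow> 'o \<Rightarrow> 'm \<Rightarrow> 'm" where
  "tensor_mult A m B m' = (m \<boxtimes> m') \<cdot> (\<iota> A \<boxtimes> \<c> B A \<boxtimes> \<iota> B)"

definition tensor_comult :: "'o \<Rightarrow> 'm \<Rightarrow> 'o \<Rightarrow> 'm \<Rightarrow> 'm" where
  "tensor_comult D d E d' = (\<iota> D \<boxtimes> \<c> D E \<boxtimes> \<iota> E) \<cdot> (d \<boxtimes> d')"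

definition hopf_algebra :: "('o, 'm) hopf \<Rightarrow> bool" where
  "hopf_algebra X \<longleftrightarrow>
     (let X0 = carrier X in
      algebra X0 (\<eta> X) (\<mu> X) \<and> coalgebra X0 (\<epsilon> X) (\<delta> X) \<and>
      algebra_morphism X0 (\<eta> X) (\<mu> X) \<K> (\<iota> \<K>) (\<iota> \<K>) (\<epsilon> X) \<and>
      algebra_morphism X0 (\<eta> X) (\<mu> X)
        (X0 \<otimes> X0) (\<eta> X \<boxtimes> \<eta> X) (tensor_mult X0 (\<mu> X) X0 (\<mu> X)) (\<delta> X) \<and>
      \<lambda>\<^sub>S X \<in> Hom C X0 X0 \<and>
      \<mu> X \<cdot> (\<lambda>\<^sub>S X \<boxtimes> \<iota> X0) \<cdot> \<delta> X = \<eta> X \<cdot> \<epsilon> X \<and>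
      \<mu> X \<cdot> (\<iota> X0 \<boxtimes> \<lambda>\<^sub>S X) \<cdot> \<delta> X = \<eta> X \<cdot> \<epsilon> X)"

definition hopf_morphism :: "('o, 'm) hopf \<Rightarrow> ('o, 'm) hopf \<Rightarrow> 'm \<Rightarrow> bool" where
  "hopf_morphism X Y f \<longleftrightarrow>
     algebra_morphism (carrier X) (\<eta> X) (\<mu> X) (carrier Y) (\<eta> Y) (\<mu> Y) f \<and>
     coalgebra_morphism (carrier X) (\<epsilon> X) (\<delta> X) (carrier Y) (\<epsilon> Y) (\<delta> Y) f"

definition hopf_unit :: "('o, 'm) hopf" where
  "hopf_unit = \<lparr>carrier = \<K>, unit = \<iota> \<K>, mult = \<iota> \<K>,
     counit = \<iota> \<K>, comult = \<iota> \<K>, antipode = \<iota> \<K>\<rparr>"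

definition hopf_tensor :: "('o, 'm) hopf \<Rightarrow> ('o, 'm) hopf \<Rightarrow> ('o, 'm) hopf" where
  "hopf_tensor X Y =
     \<lparr>carrier = carrier X \<otimes> carrier Y,
      unit = \<eta> X \<boxtimes> \<eta> Y,
      mult = tensor_mult (carrier X) (\<mu> X) (carrier Y) (\<mu> Y),
      counit = \<epsilon> X \<boxtimes> \<epsilon> Y,
      comult = tensor_comult (carrier X) (\<delta> X) (carrier Y) (\<delta> Y),
      antipode = \<lambda>\<^sub>S X \<boxtimes> \<lambda>\<^sub>S Y\<rparr>"


section \<open>Hopf bracoids\<close>

definition left_module :: "('o, 'm) hopf \<Rightarrow> 'o \<Rightarrow> 'm \<Rightarrow> bool" where
  "left_module H M \<phi> \<longleftrightarrow>
     M \<in> Obj C \<and> \<phi> \<in> Hom C (carrier H \<otimes> M) M \<and>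
     \<phi> \<cdot> (\<eta> H \<boxtimes> \<iota> M) = \<iota> M \<and>
     \<phi> \<cdot> (\<iota> (carrier H) \<boxtimes> \<phi>) = \<phi> \<cdot> (\<mu> H \<boxtimes> \<iota> M)"

definition bracoid_u :: "('o, 'm) bracoid \<Rightarrow> 'm" where
  "bracoid_u = (\<lambda>(H, B, \<phi>). \<phi> \<cdot> (\<iota> (carrier H) \<boxtimes> \<eta> B))"

definition bracoid_Phi :: "('o, 'm) bracoid \<Rightarrow> 'm" where
  "bracoid_Phi = (\<lambda>(H, B, \<phi>).
     \<mu> B \<cdot> ((\<lambda>\<^sub>S B \<cdot> bracoid_u (H, B, \<phi>)) \<boxtimes> \<phi>) \<cdot> (\<delta> H \<boxtimes> \<iota> (carrier B)))"

definition hopf_bracoid :: "('o, 'm) bracoid \<Rightarrow> bool" where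
  "hopf_bracoid = (\<lambda>(H, B, \<phi>).
     hopf_algebra H \<and> hopf_algebra B \<and> left_module H (carrier B) \<phi> \<and>
     \<phi> \<cdot> (\<iota> (carrier H) \<boxtimes> \<mu> B) =
       \<mu> B \<cdot> (\<phi> \<boxtimes> bracoid_Phi (H, B, \<phi>))
         \<cdot> (\<iota> (carrier H) \<boxtimes> \<c> (carrier H) (carrier B) \<boxtimes> \<iota> (carrier B))
         \<cdot> (\<delta> H \<boxtimes> \<iota> (carrier B) \<boxtimes> \<iota> (carrier B)))"

definition bracoid_morphism :: "('o, 'm) bracoid \<Rightarrow> ('o, 'm) bracoid \<Rightarrow> 'm \<times> 'm \<Rightarrow> bool" where
  "bracoid_morphism = (\<lambda>(H, B, \<phi>) (H', B', \<phi>') (f, g).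
     hopf_morphism H H' f \<and> hopf_morphism B B' g \<and> g \<cdot> \<phi> = \<phi>' \<cdot> (f \<boxtimes> g))"

definition bracoid_tensor ::
  "('o, 'm) bracoid \<Rightarrow> ('o, 'm) bracoid \<Rightarrow> ('o, 'm) bracoid" where
  "bracoid_tensor = (\<lambda>(H, B, \<phi>) (A, D, \<psi>).
     (hopf_tensor H A, hopf_tensor B D,
      (\<phi> \<boxtimes> \<psi>) \<cdot> (\<iota> (carrier H) \<boxtimes> \<c> (carrier A) (carrier B) \<boxtimes> \<iota> (carrier D))))"

definition HBrcd :: "(('o, 'm) bracoid, 'm \<times> 'm) braided_cat" where
  "HBrcd =
     \<lparr>Obj = {X. hopf_bracoid X},
      Hom = (\<lambda>X Y. {h. bracoid_morphism X Y h}),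
      Id = (\<lambda>(H, B, \<phi>). (\<iota> (carrier H), \<iota> (carrier B))),
      Comp = (\<lambda>(f', g') (f, g). (f' \<cdot> f, g' \<cdot> g)),
      tensor_obj = bracoid_tensor,
      tensor_arr = (\<lambda>(f, g) (f', g'). (f \<boxtimes> f', g \<boxtimes> g')),
      unit_obj = (hopf_unit, hopf_unit, \<iota> \<K>),
      associator = (\<lambda>(H, B, _) (A, D, _) (P, Q, _).
        (\<alpha> (carrier H) (carrier A) (carrier P), \<alpha> (carrier B) (carrier D) (carrier Q))),
      left_unitor = (\<lambda>(H, B, _). (\<ll> (carrier H), \<ll> (carrier B))),
      right_unitor = (\<lambda>(H, B, _). (\<rr> (carrier H), \<rr> (carrier B))),
      braiding = (\<lambda>(H, B, _) (A, D, _).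
        (\<c> (carrier H) (carrier A), \<c> (carrier B) (carrier D)))\<rparr>"

end

end

theory Submission
  imports Defs
begin

text \<open>
  Hopf bracoids are defined by diagrams in a symmetric monoidal category, so every strong symmetric
  monoidal functor preserves them. The tensor product of a symmetric monoidal category \<open>C\<close> is such a
  functor \<open>C \<times> C \<rightarrow> C\<close>, its structure isomorphism being the middle-four interchange
  \<open>P \<otimes> P' \<otimes> Q \<otimes> Q' \<rightarrow> P \<otimes> Q \<otimes> P' \<otimes> Q'\<close>, and it sends a pair of Hopf bracoids to their tensor
  product. Since \<open>C\<close> is strict, the tensor product of Hopf bracoids is strictly associative and
  unital, so the coherence isomorphisms are identities; the remaining axioms hold componentwise.
\<close>

section \<open>Typed arrows\<close>

text \<open>A direct check of the bracoid law on \<open>B \<otimes> D\<close> would interleave two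
  comultiplications, two maps Phi and many braidings in one long composite. In functorial form the
  equation is that of a single bracoid, and only the comparison isomorphisms have to be moved out of
  the way. Braidings are then met in one computation, \<open>\<theta>_interchange\<close>, which
  serves the bialgebra law and the bracoid law alike. Symmetry is what makes the interchange
  compatible with braidings: for a mere braiding the tensor product is still a monoidal functor, but
  in general not a braided one. The same compatibility later shows that the braiding is a morphism
  of bracoids. As objects of \<open>HBrcd\<close> are tuples of structure morphisms, strict
  associativity there means equality of every one of these morphisms; this rests on the coherence of
  the interchange in two forms, one for operations and one for comultiplications.\<close>

text \<open>
  As hom-sets may overlap, a morphism does not determine its end points. Carrying them along makes
  every side condition of a categorical law decidable by rewriting.
\<close>

datatype ('o, 'm) arrow = Arrow (src: 'o) (und: 'm) (tgt: 'o)

definition arr :: "('o, 'm, 'x) cat_scheme \<Rightarrow> ('o, 'm) arrow \<Rightarrow> bool" where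
  "arr C f \<longleftrightarrow> src f \<in> Obj C \<and> tgt f \<in> Obj C \<and> und f \<in> Hom C (src f) (tgt f)"

text \<open>Composition is total and does not detect mismatched end points, so the laws below carry
  \<open>src g = tgt f\<close> as a premise.\<close>

definition acomp :: "('o, 'm, 'x) cat_scheme \<Rightarrow> ('o, 'm) arrow \<Rightarrow> ('o, 'm) arrow \<Rightarrow> ('o, 'm) arrow"
    (infixr "\<odot>\<index>" 60) where
  "acomp C g f = Arrow (src f) (und g \<cdot>\<^bsub>C\<^esub> und f) (tgt g)"

definition aid :: "('o, 'm, 'x) cat_scheme \<Rightarrow> 'o \<Rightarrow> ('o, 'm) arrow" ("\<one>\<index>") where
  "aid C P = Arrow P (\<iota>\<^bsub>C\<^esub> P) P"

definition atens :: "('o, 'm, 'x) monoidal_cat_scheme \<Rightarrow> ('o, 'm) arrow \<Rightarrow> ('o, 'm) arrow \<Rightarrow> ('o, 'm) arrow"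
    (infixr "\<star>\<index>" 70) where
  "atens C f g = Arrow (src f \<otimes>\<^bsub>C\<^esub> src g) (und f \<boxtimes>\<^bsub>C\<^esub> und g) (tgt f \<otimes>\<^bsub>C\<^esub> tgt g)"

definition abraid :: "('o, 'm, 'x) braided_cat_scheme \<Rightarrow> 'o \<Rightarrow> 'o \<Rightarrow> ('o, 'm) arrow" ("\<gamma>\<index>") where
  "abraid C P Q = Arrow (P \<otimes>\<^bsub>C\<^esub> Q) (\<c>\<^bsub>C\<^esub> P Q) (Q \<otimes>\<^bsub>C\<^esub> P)"

lemma acomp_sel [simp]:
  "src (acomp C g f) = src f" "tgt (acomp C g f) = tgt g" "und (acomp C g f) = und g \<cdot>\<^bsub>C\<^esub> und f"
  by (simp_all add: acomp_def)

lemma aid_sel [simp]: "src (aid C P) = P" "tgt (aid C P) = P" "und (aid C P) = \<iota>\<^bsub>C\<^esub> P"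
  by (simp_all add: aid_def)

lemma atens_sel [simp]:
  "src (atens C f g) = src f \<otimes>\<^bsub>C\<^esub> src g" "tgt (atens C f g) = tgt f \<otimes>\<^bsub>C\<^esub> tgt g"
  "und (atens C f g) = und f \<boxtimes>\<^bsub>C\<^esub> und g"
  by (simp_all add: atens_def)

lemma abraid_sel [simp]:
  "src (abraid C P Q) = P \<otimes>\<^bsub>C\<^esub> Q" "tgt (abraid C P Q) = Q \<otimes>\<^bsub>C\<^esub> P"
  "und (abraid C P Q) = \<c>\<^bsub>C\<^esub> P Q"
  by (simp_all add: abraid_def)

lemma arrow_eq_iff: "f = g \<longleftrightarrow> src f = src g \<and> und f = und g \<and> tgt f = tgt g"
  by (auto intro: arrow.expand)

locale strict_symmetric_category = strict_monoidal_category C + symmetric_monoidal_category C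
  for C :: "('o, 'm, 'x) braided_cat_scheme" (structure)
begin

text \<open>Objects are normalised to right-bracketed products without units, so that end point
  conditions close by rewriting.\<close>

lemmas [simp] = unit_Obj tensor_Obj strict_assoc strict_left_unit strict_right_unit

lemma arr_Obj [simp]: "arr C f \<Longrightarrow> src f \<in> Obj C" "arr C f \<Longrightarrow> tgt f \<in> Obj C"
  by (auto simp: arr_def)

lemma und_Hom [simp]: "\<lbrakk>arr C f; src f = P; tgt f = Q\<rbrakk> \<Longrightarrow> und f \<in> Hom C P Q"
  by (auto simp: arr_def)

lemma arr_acomp [simp]: "\<lbrakk>arr C f; arr C g; src g = tgt f\<rbrakk> \<Longrightarrow> arr C (g \<odot> f)"
  using Comp_Hom[of "src f" "tgt f" "tgt g" "und f" "und g"] by (simp add: arr_def del: arr_Obj)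

lemma arr_aid [simp]: "arr C (\<one> P) \<longleftrightarrow> P \<in> Obj C"
  unfolding arr_def by (auto intro: Id_Hom)

lemma arr_atens [simp]: "\<lbrakk>arr C f; arr C g\<rbrakk> \<Longrightarrow> arr C (f \<star> g)"
  using tensor_Hom[of "src f" "tgt f" "src g" "tgt g" "und f" "und g"] by (simp add: arr_def del: arr_Obj)

lemma c_Hom: "\<lbrakk>P \<in> Obj C; Q \<in> Obj C\<rbrakk> \<Longrightarrow> \<c> P Q \<in> Hom C (P \<otimes> Q) (Q \<otimes> P)"
  using braiding_iso by (auto simp: isomorphism_def inverse_arrows_def)

lemma arr_abraid [simp]: "\<lbrakk>P \<in> Obj C; Q \<in> Obj C\<rbrakk> \<Longrightarrow> arr C (\<gamma> P Q)"
  unfolding arr_def by (simp add: c_Hom)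

lemma aid_left [simp]: "\<lbrakk>arr C f; tgt f = Q\<rbrakk> \<Longrightarrow> \<one> Q \<odot> f = f"
  using Id_left[of "src f" "tgt f" "und f"] by (intro arrow.expand) auto

lemma aid_right [simp]: "\<lbrakk>arr C f; src f = P\<rbrakk> \<Longrightarrow> f \<odot> \<one> P = f"
  using Id_right[of "src f" "tgt f" "und f"] by (intro arrow.expand) auto

lemma acomp_assoc [simp]:
  "\<lbrakk>arr C f; arr C g; arr C h; src g = tgt f; src h = tgt g\<rbrakk> \<Longrightarrow> (h \<odot> g) \<odot> f = h \<odot> (g \<odot> f)"
  using Comp_assoc[of "src f" "tgt f" "tgt g" "tgt h" "und f" "und g" "und h"]
  by (intro arrow.expand) simp

lemma atens_aid [simp]: "\<lbrakk>P \<in> Obj C; Q \<in> Obj C\<rbrakk> \<Longrightarrow> \<one> P \<star> \<one> Q = \<one> (P \<otimes> Q)"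
  by (intro arrow.expand) (auto simp: tensor_Id)

lemma atens_acomp:
  "\<lbrakk>arr C f; arr C f'; arr C g; arr C g'; src f' = tgt f; src g' = tgt g\<rbrakk>
    \<Longrightarrow> (f' \<star> g') \<odot> (f \<star> g) = (f' \<odot> f) \<star> (g' \<odot> g)"
  using tensor_Comp[of "src f" "tgt f" "tgt f'" "src g" "tgt g" "tgt g'" "und f" "und f'" "und g" "und g'"]
  by (intro arrow.expand) simp

text \<open>In the naturality square of the associator both associators are identities. Strictness
  on objects gives both bracketings the same end points, so these identities can be removed.\<close>

lemma atens_assoc [simp]: "\<lbrakk>arr C f; arr C g; arr C h\<rbrakk> \<Longrightarrow> (f \<star> g) \<star> h = f \<star> (g \<star> h)"
proof (intro arrow.expand conjI)
  assume a: "arr C f" "arr C g" "arr C h"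
  let ?P = "(src f \<otimes> src g) \<otimes> src h" and ?Q = "(tgt f \<otimes> tgt g) \<otimes> tgt h"
  have l: "und ((f \<star> g) \<star> h) \<in> Hom C ?P ?Q" and r: "und (f \<star> (g \<star> h)) \<in> Hom C ?P ?Q"
    using arr_atens[OF arr_atens[OF a(1,2)] a(3)] arr_atens[OF a(1) arr_atens[OF a(2,3)]] a
    by (simp_all add: arr_def del: arr_Obj)
  from a have o: "?P \<in> Obj C" "?Q \<in> Obj C" by simp_all
  show "und ((f \<star> g) \<star> h) = und (f \<star> (g \<star> h))"
    using associator_natural[of "src f" "tgt f" "src g" "tgt g" "src h" "tgt h" "und f" "und g" "und h"]
      Id_left[OF o l] Id_right[OF o r] a
    by (simp add: associator_Id)
qed simp_all

text \<open>Right nesting hides two adjacent identities from \<open>atens_aid\<close>; this rule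
  merges them in the nested form.\<close>

lemma aid_atens [simp]: "\<lbrakk>P \<in> Obj C; Q \<in> Obj C; arr C f\<rbrakk> \<Longrightarrow> \<one> P \<star> \<one> Q \<star> f = \<one> (P \<otimes> Q) \<star> f"
  by (subst atens_assoc[symmetric]) simp_all

lemma aid_unit_atens [simp]: "arr C f \<Longrightarrow> \<one> \<K> \<star> f = f"
  using left_unitor_natural[of "src f" "tgt f" "und f"] tensor_Hom[of \<K> \<K> "src f" "tgt f" "\<iota> \<K>" "und f"]
    Id_left[of "src f" "tgt f" "\<iota> \<K> \<boxtimes> und f"] Id_right[of "src f" "tgt f" "und f"]
  by (intro arrow.expand) (simp add: left_unitor_Id Id_Hom)

lemma atens_aid_unit [simp]: "arr C f \<Longrightarrow> f \<star> \<one> \<K> = f"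
  using right_unitor_natural[of "src f" "tgt f" "und f"] tensor_Hom[of "src f" "tgt f" \<K> \<K> "und f" "\<iota> \<K>"]
    Id_left[of "src f" "tgt f" "und f \<boxtimes> \<iota> \<K>"] Id_right[of "src f" "tgt f" "und f"]
  by (intro arrow.expand) (simp add: right_unitor_Id Id_Hom)

lemma abraid_natural:
  "\<lbrakk>arr C f; arr C g; P' = tgt f; Q' = tgt g\<rbrakk>
    \<Longrightarrow> \<gamma> P' Q' \<odot> (f \<star> g) = (g \<star> f) \<odot> \<gamma> (src f) (src g)"
  by (intro arrow.expand) (auto simp: braiding_natural)

lemma abraid_symmetry [simp]: "\<lbrakk>P \<in> Obj C; Q \<in> Obj C\<rbrakk> \<Longrightarrow> \<gamma> Q P \<odot> \<gamma> P Q = \<one> (P \<otimes> Q)"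
  by (intro arrow.expand) (auto simp: symmetry)

lemma abraid_tensor_right:
  assumes "P \<in> Obj C" "Q \<in> Obj C" "R \<in> Obj C"
  shows "\<gamma> P (Q \<otimes> R) = (\<one> Q \<star> \<gamma> P R) \<odot> (\<gamma> P Q \<star> \<one> R)"
proof -
  \<comment> \<open>The identity associators are kept for the moment, and \<open>aid_left\<close>
    and \<open>aid_right\<close> withheld, so that the underlying equation has the shape of the
    hexagon axiom.\<close>
  have "\<one> (Q \<otimes> R \<otimes> P) \<odot> \<gamma> P (Q \<otimes> R) \<odot> \<one> (P \<otimes> Q \<otimes> R)
      = (\<one> Q \<star> \<gamma> P R) \<odot> \<one> (Q \<otimes> P \<otimes> R) \<odot> (\<gamma> P Q \<star> \<one> R)"
    using hexagon_right[OF assms] assms by (intro arrow.expand) (simp add: associator_Id del: aid_left aid_right)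
  then show ?thesis
    using assms by simp
qed

lemma abraid_tensor_left:
  assumes "P \<in> Obj C" "Q \<in> Obj C" "R \<in> Obj C"
  shows "\<gamma> (P \<otimes> Q) R = (\<gamma> P R \<star> \<one> Q) \<odot> (\<one> P \<star> \<gamma> Q R)"
proof -
  \<comment> \<open>\<open>hexagon_left\<close> speaks of inverses of associators; an identity is
    its own inverse and can be inserted for them.\<close>
  have *: "inverse_arrows C P P (\<iota> P) (\<iota> P)" if "P \<in> Obj C" for P
    using that by (simp add: inverse_arrows_def Id_Hom Id_left[OF _ _ Id_Hom])
  have "\<one> (R \<otimes> P \<otimes> Q) \<odot> \<gamma> (P \<otimes> Q) R \<odot> \<one> (P \<otimes> Q \<otimes> R)
      = (\<gamma> P R \<star> \<one> Q) \<odot> \<one> (P \<otimes> R \<otimes> Q) \<odot> (\<one> P \<star> \<gamma> Q R)"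
    using hexagon_left[OF assms, of "\<iota> (P \<otimes> Q \<otimes> R)" "\<iota> (P \<otimes> R \<otimes> Q)" "\<iota> (R \<otimes> P \<otimes> Q)"] assms
    by (intro arrow.expand) (simp add: associator_Id * del: aid_left aid_right)
  then show ?thesis
    using assms by simp
qed

text \<open>The hexagon for two unit factors says that \<open>\<gamma> P \<K>\<close> is idempotent;
  being invertible by symmetry, it is an identity.\<close>

lemma abraid_unit_right [simp]:
  assumes "P \<in> Obj C"
  shows "\<gamma> P \<K> = \<one> P"
proof -
  have "\<gamma> P \<K> = \<gamma> P \<K> \<odot> \<gamma> P \<K>"
    using abraid_tensor_right[of P \<K> \<K>] assms by simp
  then have "\<gamma> \<K> P \<odot> \<gamma> P \<K> = \<gamma> \<K> P \<odot> \<gamma> P \<K> \<odot> \<gamma> P \<K>"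
    by simp
  also have "\<dots> = (\<gamma> \<K> P \<odot> \<gamma> P \<K>) \<odot> \<gamma> P \<K>"
    using assms by (subst acomp_assoc) auto
  finally show ?thesis
    using assms by simp
qed

lemma abraid_unit_left [simp]: "P \<in> Obj C \<Longrightarrow> \<gamma> \<K> P = \<one> P"
  using abraid_symmetry[of P \<K>] by simp

text \<open>Composites are nested to the right, so inside a longer one the left-hand side
  \<open>g \<odot> f\<close> of a rule occurs only as \<open>g \<odot> (f \<odot> x)\<close>. This
  turns an equation into the rule for that shape.\<close>

lemma reassoc:
  assumes "g \<odot> f = h" and "arr C f" "arr C g" "src g = tgt f" and "arr C x" "tgt x = src f"
  shows "g \<odot> (f \<odot> x) = h \<odot> x"
  using assms by (metis acomp_assoc)

lemma whisker_right:
  "\<lbrakk>arr C f; arr C g; src g = tgt f; P \<in> Obj C\<rbrakk> \<Longrightarrow> (g \<odot> f) \<star> \<one> P = (g \<star> \<one> P) \<odot> (f \<star> \<one> P)"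
  by (simp add: atens_acomp)

lemma whisker_left:
  "\<lbrakk>arr C f; arr C g; src g = tgt f; P \<in> Obj C\<rbrakk> \<Longrightarrow> \<one> P \<star> (g \<odot> f) = (\<one> P \<star> g) \<odot> (\<one> P \<star> f)"
  by (simp add: atens_acomp)

end

section \<open>Hopf structures as typed arrows\<close>

definition aunit :: "('o, 'm, 'x) braided_cat_scheme \<Rightarrow> ('o, 'm) hopf \<Rightarrow> ('o, 'm) arrow" where
  "aunit C X = Arrow \<K>\<^bsub>C\<^esub> (\<eta> X) (carrier X)"

definition amult :: "('o, 'm, 'x) braided_cat_scheme \<Rightarrow> ('o, 'm) hopf \<Rightarrow> ('o, 'm) arrow" where
  "amult C X = Arrow (carrier X \<otimes>\<^bsub>C\<^esub> carrier X) (\<mu> X) (carrier X)"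

definition acounit :: "('o, 'm, 'x) braided_cat_scheme \<Rightarrow> ('o, 'm) hopf \<Rightarrow> ('o, 'm) arrow" where
  "acounit C X = Arrow (carrier X) (\<epsilon> X) \<K>\<^bsub>C\<^esub>"

definition acomult :: "('o, 'm, 'x) braided_cat_scheme \<Rightarrow> ('o, 'm) hopf \<Rightarrow> ('o, 'm) arrow" where
  "acomult C X = Arrow (carrier X) (\<delta> X) (carrier X \<otimes>\<^bsub>C\<^esub> carrier X)"

definition aantipode :: "('o, 'm) hopf \<Rightarrow> ('o, 'm) arrow" where
  "aantipode X = Arrow (carrier X) (\<lambda>\<^sub>S X) (carrier X)"

text \<open>The raw action does not determine its end points, hence the whole triple as
  argument.\<close>

definition aaction :: "('o, 'm, 'x) braided_cat_scheme \<Rightarrow> ('o, 'm) bracoid \<Rightarrow> ('o, 'm) arrow" where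
  "aaction C = (\<lambda>(H, B, \<phi>). Arrow (carrier H \<otimes>\<^bsub>C\<^esub> carrier B) \<phi> (carrier B))"

definition aPhi :: "('o, 'm, 'x) braided_cat_scheme \<Rightarrow> ('o, 'm) bracoid \<Rightarrow> ('o, 'm) arrow" where
  "aPhi C = (\<lambda>(H, B, \<phi>).
     amult C B \<odot>\<^bsub>C\<^esub>
       ((aantipode B \<odot>\<^bsub>C\<^esub> aaction C (H, B, \<phi>) \<odot>\<^bsub>C\<^esub> (\<one>\<^bsub>C\<^esub> (carrier H) \<star>\<^bsub>C\<^esub> aunit C B))
         \<star>\<^bsub>C\<^esub> aaction C (H, B, \<phi>))
       \<odot>\<^bsub>C\<^esub> (acomult C H \<star>\<^bsub>C\<^esub> \<one>\<^bsub>C\<^esub> (carrier B)))"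

lemma hopf_sel [simp]:
  "src (aunit C X) = \<K>\<^bsub>C\<^esub>" "tgt (aunit C X) = carrier X" "und (aunit C X) = \<eta> X"
  "src (amult C X) = carrier X \<otimes>\<^bsub>C\<^esub> carrier X" "tgt (amult C X) = carrier X" "und (amult C X) = \<mu> X"
  "src (acounit C X) = carrier X" "tgt (acounit C X) = \<K>\<^bsub>C\<^esub>" "und (acounit C X) = \<epsilon> X"
  "src (acomult C X) = carrier X" "tgt (acomult C X) = carrier X \<otimes>\<^bsub>C\<^esub> carrier X"
  "und (acomult C X) = \<delta> X"
  "src (aantipode X) = carrier X" "tgt (aantipode X) = carrier X" "und (aantipode X) = \<lambda>\<^sub>S X"
  "src (aaction C (H, B, \<phi>)) = carrier H \<otimes>\<^bsub>C\<^esub> carrier B" "tgt (aaction C (H, B, \<phi>)) = carrier B"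
  "und (aaction C (H, B, \<phi>)) = \<phi>"
  by (simp_all add: aunit_def amult_def acounit_def acomult_def aantipode_def aaction_def)

context strict_symmetric_category
begin

text \<open>The passage between raw and typed axioms, in both directions: hypotheses are unpacked
  and conclusions established in typed form.\<close>

lemma hopf_algebra_iff:
  "hopf_algebra C X \<longleftrightarrow>
    arr C (aunit C X) \<and> arr C (amult C X) \<and> arr C (acounit C X) \<and> arr C (acomult C X) \<and>
    arr C (aantipode X) \<and>
    amult C X \<odot> (aunit C X \<star> \<one> (carrier X)) = \<one> (carrier X) \<and>
    amult C X \<odot> (\<one> (carrier X) \<star> aunit C X) = \<one> (carrier X) \<and>
    amult C X \<odot> (amult C X \<star> \<one> (carrier X)) = amult C X \<odot> (\<one> (carrier X) \<star> amult C X) \<and>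
    (acounit C X \<star> \<one> (carrier X)) \<odot> acomult C X = \<one> (carrier X) \<and>
    (\<one> (carrier X) \<star> acounit C X) \<odot> acomult C X = \<one> (carrier X) \<and>
    (acomult C X \<star> \<one> (carrier X)) \<odot> acomult C X = (\<one> (carrier X) \<star> acomult C X) \<odot> acomult C X \<and>
    acounit C X \<odot> aunit C X = \<one> \<K> \<and>
    acounit C X \<odot> amult C X = acounit C X \<star> acounit C X \<and>
    acomult C X \<odot> aunit C X = aunit C X \<star> aunit C X \<and>
    acomult C X \<odot> amult C X
      = (amult C X \<star> amult C X) \<odot> (\<one> (carrier X) \<star> \<gamma> (carrier X) (carrier X) \<star> \<one> (carrier X))
        \<odot> (acomult C X \<star> acomult C X) \<and>
    amult C X \<odot> (aantipode X \<star> \<one> (carrier X)) \<odot> acomult C X = aunit C X \<odot> acounit C X \<and>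
    amult C X \<odot> (\<one> (carrier X) \<star> aantipode X) \<odot> acomult C X = aunit C X \<odot> acounit C X"
  (is "_ = ?r")
\<comment> \<open>Unit laws and rebracketing hold for typed morphisms only, which forces the case
  split; without typing both sides are false.\<close>
proof (cases "arr C (aunit C X) \<and> arr C (amult C X) \<and> arr C (acounit C X) \<and> arr C (acomult C X) \<and>
    arr C (aantipode X)")
  case True
  then have arrs [simp]: "arr C (aunit C X)" "arr C (amult C X)" "arr C (acounit C X)"
    "arr C (acomult C X)" "arr C (aantipode X)"
    by simp_all
  have [simp]: "carrier X \<in> Obj C"
    using arr_Obj[OF arrs(3)] by simp
  have [simp]: "\<eta> X \<in> Hom C \<K> (carrier X)" "\<mu> X \<in> Hom C (carrier X \<otimes> carrier X) (carrier X)"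
    "\<epsilon> X \<in> Hom C (carrier X) \<K>" "\<delta> X \<in> Hom C (carrier X) (carrier X \<otimes> carrier X)"
    "\<lambda>\<^sub>S X \<in> Hom C (carrier X) (carrier X)"
    using arrs[THEN und_Hom] by simp_all
  \<comment> \<open>By definition the counit is multiplicative with respect to the product
    \<open>\<iota> \<K>\<close> of the unit algebra; that factor is absorbed here.\<close>
  have 1: "\<iota> \<K> \<cdot> (\<epsilon> X \<boxtimes> \<epsilon> X) = \<epsilon> X \<boxtimes> \<epsilon> X"
    using arg_cong[of _ _ und, OF aid_left[of "acounit C X \<star> acounit C X" \<K>]] by (simp del: aid_left)
  \<comment> \<open>\<open>tensor_mult\<close> is itself a composite standing on the left of another
    morphism and has to be rebracketed.\<close>
  have 2: "tensor_mult C (carrier X) (\<mu> X) (carrier X) (\<mu> X) \<cdot> (\<delta> X \<boxtimes> \<delta> X)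
      = (\<mu> X \<boxtimes> \<mu> X) \<cdot> (\<iota> (carrier X) \<boxtimes> \<c> (carrier X) (carrier X) \<boxtimes> \<iota> (carrier X)) \<cdot> (\<delta> X \<boxtimes> \<delta> X)"
    using arg_cong[of _ _ und, OF acomp_assoc[of "acomult C X \<star> acomult C X"
        "\<one> (carrier X) \<star> \<gamma> (carrier X) (carrier X) \<star> \<one> (carrier X)" "amult C X \<star> amult C X"]]
    by (simp add: tensor_mult_def del: acomp_assoc)
  show ?thesis
    unfolding hopf_algebra_def algebra_def coalgebra_def algebra_morphism_def
    by (simp add: arrow_eq_iff 1 2 Let_def)
next
  case False
  have "\<not> hopf_algebra C X"
  proof
    assume "hopf_algebra C X"
    then show False
      using False unit_Obj
      by (simp add: hopf_algebra_def algebra_def coalgebra_def arr_def Let_def del: arr_Obj)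
  qed
  with False show ?thesis
    by blast
qed

lemma und_aPhi: "und (aPhi C (H, B, \<phi>)) = bracoid_Phi C (H, B, \<phi>)"
  by (simp add: aPhi_def bracoid_Phi_def bracoid_u_def)

lemma hopf_arr:
  assumes "hopf_algebra C X"
  shows "carrier X \<in> Obj C" "arr C (aunit C X)" "arr C (amult C X)" "arr C (acounit C X)"
    "arr C (acomult C X)" "arr C (aantipode X)"
  using assms arr_Obj(1)[of "acounit C X"] unfolding hopf_algebra_iff by auto

lemma hopf_bracoid_iff:
  "hopf_bracoid C (H, B, \<phi>) \<longleftrightarrow>
    hopf_algebra C H \<and> hopf_algebra C B \<and> arr C (aaction C (H, B, \<phi>)) \<and>
    aaction C (H, B, \<phi>) \<odot> (aunit C H \<star> \<one> (carrier B)) = \<one> (carrier B) \<and>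
    aaction C (H, B, \<phi>) \<odot> (\<one> (carrier H) \<star> aaction C (H, B, \<phi>))
      = aaction C (H, B, \<phi>) \<odot> (amult C H \<star> \<one> (carrier B)) \<and>
    aaction C (H, B, \<phi>) \<odot> (\<one> (carrier H) \<star> amult C B)
      = amult C B \<odot> (aaction C (H, B, \<phi>) \<star> aPhi C (H, B, \<phi>))
        \<odot> (\<one> (carrier H) \<star> \<gamma> (carrier H) (carrier B) \<star> \<one> (carrier B))
        \<odot> (acomult C H \<star> \<one> (carrier B \<otimes> carrier B))"
\<comment> \<open>Only for objects does \<open>tensor_Id\<close> merge the two identities on
  \<open>carrier B\<close> in the definition into one on
  \<open>carrier B \<otimes> carrier B\<close>.\<close>
proof (cases "hopf_algebra C H \<and> hopf_algebra C B")
  case True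
  then have [simp]: "carrier H \<in> Obj C" "carrier B \<in> Obj C"
    by (simp_all add: hopf_arr)
  have [simp]: "arr C (aaction C (H, B, \<phi>)) \<longleftrightarrow> \<phi> \<in> Hom C (carrier H \<otimes> carrier B) (carrier B)"
    by (simp add: arr_def del: arr_Obj)
  have [simp]: "src (aPhi C (H, B, \<phi>)) = carrier H \<otimes> carrier B" "tgt (aPhi C (H, B, \<phi>)) = carrier B"
    by (simp_all add: aPhi_def)
  show ?thesis
    using True unfolding hopf_bracoid_def left_module_def
    by (auto simp add: arrow_eq_iff und_aPhi tensor_Id)
qed (auto simp: hopf_bracoid_def)

end

section \<open>Symmetric monoidal functors\<close>

text \<open>Strictness refers to the two categories. The functor is a strong one, with
  \<open>\<theta>\<close> comparing tensor products and \<open>\<theta>'\<close> inverse to it,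
  normalised so that the unit object is preserved on the nose. \<open>F_acomp\<close> is oriented so
  as to collect images under a single \<open>F\<close>, where the axioms of the source category can
  be applied.\<close>

locale strict_symmetric_functor =
  D: strict_symmetric_category D + C: strict_symmetric_category C
  for D :: "('p, 'n, 'y) braided_cat_scheme" and C :: "('o, 'm, 'x) braided_cat_scheme" (structure) +
  fixes Fo :: "'p \<Rightarrow> 'o"
    and F :: "('p, 'n) arrow \<Rightarrow> ('o, 'm) arrow"
    and \<theta> \<theta>' :: "'p \<Rightarrow> 'p \<Rightarrow> ('o, 'm) arrow"
  assumes Fo_Obj [simp]: "P \<in> Obj D \<Longrightarrow> Fo P \<in> Obj C"
    and Fo_unit [simp]: "Fo \<K>\<^bsub>D\<^esub> = \<K>"
    and arr_F [simp]: "arr D f \<Longrightarrow> arr C (F f)"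
    and src_F [simp]: "src (F f) = Fo (src f)"
    and tgt_F [simp]: "tgt (F f) = Fo (tgt f)"
    and F_aid [simp]: "P \<in> Obj D \<Longrightarrow> F (\<one>\<^bsub>D\<^esub> P) = \<one> (Fo P)"
    and F_acomp: "\<lbrakk>arr D f; arr D g; src g = tgt f\<rbrakk> \<Longrightarrow> F g \<odot> F f = F (g \<odot>\<^bsub>D\<^esub> f)"
    and arr_\<theta> [simp]: "\<lbrakk>P \<in> Obj D; Q \<in> Obj D\<rbrakk> \<Longrightarrow> arr C (\<theta> P Q)"
    and arr_\<theta>' [simp]: "\<lbrakk>P \<in> Obj D; Q \<in> Obj D\<rbrakk> \<Longrightarrow> arr C (\<theta>' P Q)"
    and src_\<theta> [simp]: "\<lbrakk>P \<in> Obj D; Q \<in> Obj D\<rbrakk> \<Longrightarrow> src (\<theta> P Q) = Fo P \<otimes> Fo Q"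
    and tgt_\<theta> [simp]: "\<lbrakk>P \<in> Obj D; Q \<in> Obj D\<rbrakk> \<Longrightarrow> tgt (\<theta> P Q) = Fo (P \<otimes>\<^bsub>D\<^esub> Q)"
    and src_\<theta>' [simp]: "\<lbrakk>P \<in> Obj D; Q \<in> Obj D\<rbrakk> \<Longrightarrow> src (\<theta>' P Q) = Fo (P \<otimes>\<^bsub>D\<^esub> Q)"
    and tgt_\<theta>' [simp]: "\<lbrakk>P \<in> Obj D; Q \<in> Obj D\<rbrakk> \<Longrightarrow> tgt (\<theta>' P Q) = Fo P \<otimes> Fo Q"
    and \<theta>_\<theta>' [simp]: "\<lbrakk>P \<in> Obj D; Q \<in> Obj D\<rbrakk> \<Longrightarrow> \<theta> P Q \<odot> \<theta>' P Q = \<one> (Fo (P \<otimes>\<^bsub>D\<^esub> Q))"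
    and \<theta>'_\<theta> [simp]: "\<lbrakk>P \<in> Obj D; Q \<in> Obj D\<rbrakk> \<Longrightarrow> \<theta>' P Q \<odot> \<theta> P Q = \<one> (Fo P \<otimes> Fo Q)"
    and \<theta>_natural: "\<lbrakk>arr D f; arr D g\<rbrakk>
      \<Longrightarrow> \<theta> (tgt f) (tgt g) \<odot> (F f \<star> F g) = F (f \<star>\<^bsub>D\<^esub> g) \<odot> \<theta> (src f) (src g)"
    and \<theta>_assoc: "\<lbrakk>P \<in> Obj D; Q \<in> Obj D; R \<in> Obj D\<rbrakk>
      \<Longrightarrow> \<theta> (P \<otimes>\<^bsub>D\<^esub> Q) R \<odot> (\<theta> P Q \<star> \<one> (Fo R)) = \<theta> P (Q \<otimes>\<^bsub>D\<^esub> R) \<odot> (\<one> (Fo P) \<star> \<theta> Q R)"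
    and \<theta>_unit_left [simp]: "P \<in> Obj D \<Longrightarrow> \<theta> \<K>\<^bsub>D\<^esub> P = \<one> (Fo P)"
    and \<theta>_unit_right [simp]: "P \<in> Obj D \<Longrightarrow> \<theta> P \<K>\<^bsub>D\<^esub> = \<one> (Fo P)"
    and \<theta>_braid: "\<lbrakk>P \<in> Obj D; Q \<in> Obj D\<rbrakk>
      \<Longrightarrow> \<theta> Q P \<odot> \<gamma> (Fo P) (Fo Q) = F (\<gamma>\<^bsub>D\<^esub> P Q) \<odot> \<theta> P Q"
begin

section \<open>Naturality and coherence of the comparison isomorphisms\<close>

lemma F_acomp_reassoc:
  "\<lbrakk>arr D f; arr D g; src g = tgt f; arr C x; tgt x = Fo (src f)\<rbrakk>
    \<Longrightarrow> F g \<odot> F f \<odot> x = F (g \<odot>\<^bsub>D\<^esub> f) \<odot> x"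
  by (rule C.reassoc) (simp_all add: F_acomp)

lemma \<theta>'_unit_left [simp]: "P \<in> Obj D \<Longrightarrow> \<theta>' \<K>\<^bsub>D\<^esub> P = \<one> (Fo P)"
  using \<theta>_\<theta>'[of "\<K>\<^bsub>D\<^esub>" P] by simp

lemma \<theta>'_unit_right [simp]: "P \<in> Obj D \<Longrightarrow> \<theta>' P \<K>\<^bsub>D\<^esub> = \<one> (Fo P)"
  using \<theta>_\<theta>'[of P "\<K>\<^bsub>D\<^esub>"] by simp

lemma \<theta>_\<theta>'_reassoc [simp]:
  "\<lbrakk>P \<in> Obj D; Q \<in> Obj D; arr C x; tgt x = Fo (P \<otimes>\<^bsub>D\<^esub> Q)\<rbrakk> \<Longrightarrow> \<theta> P Q \<odot> \<theta>' P Q \<odot> x = x"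
  by (subst C.acomp_assoc[symmetric]) simp_all

lemma \<theta>'_\<theta>_reassoc [simp]:
  "\<lbrakk>P \<in> Obj D; Q \<in> Obj D; arr C x; tgt x = Fo P \<otimes> Fo Q\<rbrakk> \<Longrightarrow> \<theta>' P Q \<odot> \<theta> P Q \<odot> x = x"
  by (subst C.acomp_assoc[symmetric]) simp_all

lemma \<theta>_nat:
  "\<lbrakk>arr D f; arr D g; P = tgt f; Q = tgt g\<rbrakk>
    \<Longrightarrow> \<theta> P Q \<odot> (F f \<star> F g) = F (f \<star>\<^bsub>D\<^esub> g) \<odot> \<theta> (src f) (src g)"
  by (simp add: \<theta>_natural)

lemma \<theta>_nat_left:
  "\<lbrakk>arr D f; R \<in> Obj D; P = tgt f; Q = R\<rbrakk>
    \<Longrightarrow> \<theta> P Q \<odot> (F f \<star> \<one> (Fo R)) = F (f \<star>\<^bsub>D\<^esub> \<one>\<^bsub>D\<^esub> R) \<odot> \<theta> (src f) R"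
  using \<theta>_natural[of f "\<one>\<^bsub>D\<^esub> R"] by simp

lemma \<theta>_nat_right:
  "\<lbrakk>arr D f; R \<in> Obj D; Q = tgt f; P = R\<rbrakk>
    \<Longrightarrow> \<theta> P Q \<odot> (\<one> (Fo R) \<star> F f) = F (\<one>\<^bsub>D\<^esub> R \<star>\<^bsub>D\<^esub> f) \<odot> \<theta> R (src f)"
  using \<theta>_natural[of "\<one>\<^bsub>D\<^esub> R" f] by simp

text \<open>Naturality of \<open>\<theta>\<close>, conjugated:
  \<open>\<theta>' \<odot> \<theta>\<close> is inserted at the target, and
  \<open>\<theta> \<odot> \<theta>'\<close> cancels at the source.\<close>

lemma \<theta>'_nat:
  assumes "arr D f" "arr D g" "P = src f" "Q = src g"
  shows "(F f \<star> F g) \<odot> \<theta>' P Q = \<theta>' (tgt f) (tgt g) \<odot> F (f \<star>\<^bsub>D\<^esub> g)"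
proof -
  have "(F f \<star> F g) \<odot> \<theta>' P Q
      = \<theta>' (tgt f) (tgt g) \<odot> (\<theta> (tgt f) (tgt g) \<odot> (F f \<star> F g)) \<odot> \<theta>' P Q"
    using assms by simp
  also have "\<dots> = \<theta>' (tgt f) (tgt g) \<odot> F (f \<star>\<^bsub>D\<^esub> g)"
    unfolding \<theta>_natural[OF assms(1,2)] using assms by simp
  finally show ?thesis .
qed

lemma \<theta>'_nat_left:
  "\<lbrakk>arr D f; R \<in> Obj D; P = src f; Q = R\<rbrakk>
    \<Longrightarrow> (F f \<star> \<one> (Fo R)) \<odot> \<theta>' P Q = \<theta>' (tgt f) R \<odot> F (f \<star>\<^bsub>D\<^esub> \<one>\<^bsub>D\<^esub> R)"
  using \<theta>'_nat[of f "\<one>\<^bsub>D\<^esub> R"] by simp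

lemma \<theta>'_nat_right:
  "\<lbrakk>arr D f; R \<in> Obj D; Q = src f; P = R\<rbrakk>
    \<Longrightarrow> (\<one> (Fo R) \<star> F f) \<odot> \<theta>' P Q = \<theta>' R (tgt f) \<odot> F (\<one>\<^bsub>D\<^esub> R \<star>\<^bsub>D\<^esub> f)"
  using \<theta>'_nat[of "\<one>\<^bsub>D\<^esub> R" f] by simp

lemmas \<theta>_nat_reassoc =
  C.reassoc[OF \<theta>_nat] C.reassoc[OF \<theta>_nat_left] C.reassoc[OF \<theta>_nat_right]
  C.reassoc[OF \<theta>'_nat] C.reassoc[OF \<theta>'_nat_left] C.reassoc[OF \<theta>'_nat_right]

lemmas \<theta>_nats = \<theta>_nat \<theta>_nat_left \<theta>_nat_right \<theta>'_nat \<theta>'_nat_left \<theta>'_nat_right \<theta>_nat_reassoc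

text \<open>By \<open>\<theta>_assoc\<close> the composites \<open>?a\<close> and \<open>?b\<close>
  agree. Of this common morphism \<open>?l\<close> is a left inverse and \<open>?r\<close> a right
  inverse, so the two coincide.\<close>

lemma \<theta>'_assoc:
  assumes [simp]: "P \<in> Obj D" "Q \<in> Obj D" "R \<in> Obj D"
  shows "(\<theta>' P Q \<star> \<one> (Fo R)) \<odot> \<theta>' (P \<otimes>\<^bsub>D\<^esub> Q) R = (\<one> (Fo P) \<star> \<theta>' Q R) \<odot> \<theta>' P (Q \<otimes>\<^bsub>D\<^esub> R)"
    (is "?l = ?r")
proof -
  let ?a = "\<theta> (P \<otimes>\<^bsub>D\<^esub> Q) R \<odot> (\<theta> P Q \<star> \<one> (Fo R))"
  let ?b = "\<theta> P (Q \<otimes>\<^bsub>D\<^esub> R) \<odot> (\<one> (Fo P) \<star> \<theta> Q R)"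
  have a: "?l \<odot> ?a = \<one> (Fo P \<otimes> Fo Q \<otimes> Fo R)"
    by (simp add: C.atens_acomp)
  have b: "?b \<odot> ?r = \<one> (Fo (P \<otimes>\<^bsub>D\<^esub> Q \<otimes>\<^bsub>D\<^esub> R))"
  proof -
    have "?b \<odot> ?r = \<theta> P (Q \<otimes>\<^bsub>D\<^esub> R)
        \<odot> ((\<one> (Fo P) \<star> \<theta> Q R) \<odot> (\<one> (Fo P) \<star> \<theta>' Q R)) \<odot> \<theta>' P (Q \<otimes>\<^bsub>D\<^esub> R)"
      by simp
    also have "\<dots> = \<one> (Fo (P \<otimes>\<^bsub>D\<^esub> Q \<otimes>\<^bsub>D\<^esub> R))"
      by (subst C.atens_acomp) simp_all
    finally show ?thesis .
  qed
  have "?l = ?l \<odot> (?b \<odot> ?r)"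
    unfolding b by simp
  also have "\<dots> = (?l \<odot> ?a) \<odot> ?r"
    unfolding \<theta>_assoc[OF assms] by simp
  also have "\<dots> = ?r"
    unfolding a by simp
  finally show ?thesis .
qed

text \<open>Two uses of associativity make the comparison start with the two middle factors, so that
  \<open>\<theta> Q R\<close> comes next to anything that acts on them.\<close>

lemma \<theta>_four:
  assumes [simp]: "P \<in> Obj D" "Q \<in> Obj D" "R \<in> Obj D" "S \<in> Obj D"
  shows "\<theta> (P \<otimes>\<^bsub>D\<^esub> Q) (R \<otimes>\<^bsub>D\<^esub> S) \<odot> (\<theta> P Q \<star> \<theta> R S)
    = \<theta> P (Q \<otimes>\<^bsub>D\<^esub> R \<otimes>\<^bsub>D\<^esub> S) \<odot> (\<one> (Fo P) \<star> \<theta> (Q \<otimes>\<^bsub>D\<^esub> R) S) \<odot> (\<one> (Fo P) \<star> \<theta> Q R \<star> \<one> (Fo S))"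
proof -
  have "\<theta> (P \<otimes>\<^bsub>D\<^esub> Q) (R \<otimes>\<^bsub>D\<^esub> S) \<odot> (\<theta> P Q \<star> \<theta> R S)
      = (\<theta> (P \<otimes>\<^bsub>D\<^esub> Q) (R \<otimes>\<^bsub>D\<^esub> S) \<odot> (\<theta> P Q \<star> \<one> (Fo (R \<otimes>\<^bsub>D\<^esub> S))))
        \<odot> (\<one> (Fo P \<otimes> Fo Q) \<star> \<theta> R S)"
    by (simp add: C.atens_acomp)
  also have "\<dots> = \<theta> P (Q \<otimes>\<^bsub>D\<^esub> R \<otimes>\<^bsub>D\<^esub> S)
      \<odot> (\<one> (Fo P) \<star> \<theta> Q (R \<otimes>\<^bsub>D\<^esub> S)) \<odot> (\<one> (Fo P) \<star> \<one> (Fo Q) \<star> \<theta> R S)"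
    by (subst \<theta>_assoc) simp_all
  also have "\<dots> = \<theta> P (Q \<otimes>\<^bsub>D\<^esub> R \<otimes>\<^bsub>D\<^esub> S)
      \<odot> (\<one> (Fo P) \<star> (\<theta> Q (R \<otimes>\<^bsub>D\<^esub> S) \<odot> (\<one> (Fo Q) \<star> \<theta> R S)))"
    by (subst C.atens_acomp) simp_all
  also have "\<dots> = \<theta> P (Q \<otimes>\<^bsub>D\<^esub> R \<otimes>\<^bsub>D\<^esub> S)
      \<odot> (\<one> (Fo P) \<star> \<theta> (Q \<otimes>\<^bsub>D\<^esub> R) S) \<odot> (\<one> (Fo P) \<star> \<theta> Q R \<star> \<one> (Fo S))"
    by (subst \<theta>_assoc[symmetric]) (simp_all add: C.atens_acomp)
  finally show ?thesis .
qed

text \<open>Once \<open>\<theta>_four\<close> has exposed \<open>\<theta> R Q\<close>,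
  \<open>\<theta>_braid\<close> trades the braiding of \<open>C\<close> for the image of the
  braiding of \<open>D\<close>. Naturality carries this image out through the remaining comparisons,
  which are then bracketed back.\<close>

lemma \<theta>_interchange:
  assumes [simp]: "P \<in> Obj D" "Q \<in> Obj D" "R \<in> Obj D" "S \<in> Obj D"
  shows "\<theta> (P \<otimes>\<^bsub>D\<^esub> R) (Q \<otimes>\<^bsub>D\<^esub> S) \<odot> (\<theta> P R \<star> \<theta> Q S) \<odot> (\<one> (Fo P) \<star> \<gamma> (Fo Q) (Fo R) \<star> \<one> (Fo S))
    = F (\<one>\<^bsub>D\<^esub> P \<star>\<^bsub>D\<^esub> \<gamma>\<^bsub>D\<^esub> Q R \<star>\<^bsub>D\<^esub> \<one>\<^bsub>D\<^esub> S) \<odot> \<theta> (P \<otimes>\<^bsub>D\<^esub> Q) (R \<otimes>\<^bsub>D\<^esub> S) \<odot> (\<theta> P Q \<star> \<theta> R S)"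
proof -
  let ?t = "\<theta> P (R \<otimes>\<^bsub>D\<^esub> Q \<otimes>\<^bsub>D\<^esub> S)"
  have "\<theta> (P \<otimes>\<^bsub>D\<^esub> R) (Q \<otimes>\<^bsub>D\<^esub> S) \<odot> (\<theta> P R \<star> \<theta> Q S) \<odot> (\<one> (Fo P) \<star> \<gamma> (Fo Q) (Fo R) \<star> \<one> (Fo S))
      = (\<theta> (P \<otimes>\<^bsub>D\<^esub> R) (Q \<otimes>\<^bsub>D\<^esub> S) \<odot> (\<theta> P R \<star> \<theta> Q S)) \<odot> (\<one> (Fo P) \<star> \<gamma> (Fo Q) (Fo R) \<star> \<one> (Fo S))"
    by simp
  also have "\<dots> = ?t \<odot> (\<one> (Fo P) \<star> (\<theta> (R \<otimes>\<^bsub>D\<^esub> Q) S \<odot> ((\<theta> R Q \<odot> \<gamma> (Fo Q) (Fo R)) \<star> \<one> (Fo S))))"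
    by (subst \<theta>_four) (simp_all add: C.atens_acomp)
  also have "\<dots> = ?t \<odot> (\<one> (Fo P) \<star> (F (\<gamma>\<^bsub>D\<^esub> Q R \<star>\<^bsub>D\<^esub> \<one>\<^bsub>D\<^esub> S) \<odot> \<theta> (Q \<otimes>\<^bsub>D\<^esub> R) S \<odot> (\<theta> Q R \<star> \<one> (Fo S))))"
    by (simp add: \<theta>_braid C.whisker_right \<theta>_nats)
  also have "\<dots> = F (\<one>\<^bsub>D\<^esub> P \<star>\<^bsub>D\<^esub> \<gamma>\<^bsub>D\<^esub> Q R \<star>\<^bsub>D\<^esub> \<one>\<^bsub>D\<^esub> S) \<odot> \<theta> P (Q \<otimes>\<^bsub>D\<^esub> R \<otimes>\<^bsub>D\<^esub> S)
      \<odot> (\<one> (Fo P) \<star> \<theta> (Q \<otimes>\<^bsub>D\<^esub> R) S) \<odot> (\<one> (Fo P) \<star> \<theta> Q R \<star> \<one> (Fo S))"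
    by (simp add: C.whisker_left \<theta>_nats)
  finally show ?thesis
    by (simp add: \<theta>_four)
qed

section \<open>Symmetric monoidal functors preserve Hopf bracoids\<close>

definition hopf_image :: "('p, 'n) hopf \<Rightarrow> ('o, 'm) hopf" where
  "hopf_image X =
     \<lparr>carrier = Fo (carrier X), unit = und (F (aunit D X)),
      mult = und (F (amult D X) \<odot> \<theta> (carrier X) (carrier X)),
      counit = und (F (acounit D X)),
      comult = und (\<theta>' (carrier X) (carrier X) \<odot> F (acomult D X)),
      antipode = und (F (aantipode X))\<rparr>"

definition bracoid_image :: "('p, 'n) bracoid \<Rightarrow> ('o, 'm) bracoid" where
  "bracoid_image = (\<lambda>(H, B, \<phi>). (hopf_image H, hopf_image B,
     und (F (aaction D (H, B, \<phi>)) \<odot> \<theta> (carrier H) (carrier B))))"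

lemma carrier_hopf_image [simp]: "carrier (hopf_image X) = Fo (carrier X)"
  by (simp add: hopf_image_def)

lemma hopf_image_arrows:
  assumes "carrier X \<in> Obj D"
  shows "aunit C (hopf_image X) = F (aunit D X)"
    and "amult C (hopf_image X) = F (amult D X) \<odot> \<theta> (carrier X) (carrier X)"
    and "acounit C (hopf_image X) = F (acounit D X)"
    and "acomult C (hopf_image X) = \<theta>' (carrier X) (carrier X) \<odot> F (acomult D X)"
    and "aantipode (hopf_image X) = F (aantipode X)"
  using assms
  by (simp_all add: arrow_eq_iff hopf_image_def aunit_def amult_def acounit_def acomult_def aantipode_def)

text \<open>A normal form: every \<open>\<theta>\<close> moves towards the source and every
  \<open>\<theta>'\<close> towards the target, pairs that meet cancel, and what lies between is
  gathered under one \<open>F\<close>.\<close>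

lemmas F_simps = F_acomp F_acomp_reassoc \<theta>_nats C.whisker_left C.whisker_right

text \<open>Comparisons at the unit object are identities, so one of the two in each naturality
  square disappears. This serves the counit of a product and the comultiplication of the
  unit.\<close>

lemma F_atens_unit:
  assumes "arr D f" "arr D g"
  shows "tgt f = \<K>\<^bsub>D\<^esub> \<Longrightarrow> tgt g = \<K>\<^bsub>D\<^esub> \<Longrightarrow> F (f \<star>\<^bsub>D\<^esub> g) \<odot> \<theta> (src f) (src g) = F f \<star> F g"
    and "src f = \<K>\<^bsub>D\<^esub> \<Longrightarrow> src g = \<K>\<^bsub>D\<^esub> \<Longrightarrow> \<theta>' (tgt f) (tgt g) \<odot> F (f \<star>\<^bsub>D\<^esub> g) = F f \<star> F g"
  using \<theta>_natural[OF assms] \<theta>'_nat[OF assms refl refl] assms by simp_all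

text \<open>In the normal form of \<open>F_simps\<close> each law is the image of the same law of
  \<open>X\<close>. Associativity and coassociativity also need the coherence of the comparisons;
  the compatibility of product and comultiplication is the one law that involves a braiding.\<close>

lemma hopf_algebra_image:
  assumes "hopf_algebra D X"
  shows "hopf_algebra C (hopf_image X)"
proof -
  note [simp] = D.hopf_arr[OF assms] hopf_image_arrows[OF D.hopf_arr(1)[OF assms]]
  let ?A = "carrier X"
  let ?e = "aunit D X" and ?m = "amult D X" and ?t = "\<theta> ?A ?A" and ?d = "acomult D X" and ?t' = "\<theta>' ?A ?A"
  have ax: "?m \<odot>\<^bsub>D\<^esub> (?e \<star>\<^bsub>D\<^esub> \<one>\<^bsub>D\<^esub> ?A) = \<one>\<^bsub>D\<^esub> ?A"
    "?m \<odot>\<^bsub>D\<^esub> (\<one>\<^bsub>D\<^esub> ?A \<star>\<^bsub>D\<^esub> ?e) = \<one>\<^bsub>D\<^esub> ?A"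
    "?m \<odot>\<^bsub>D\<^esub> (?m \<star>\<^bsub>D\<^esub> \<one>\<^bsub>D\<^esub> ?A) = ?m \<odot>\<^bsub>D\<^esub> (\<one>\<^bsub>D\<^esub> ?A \<star>\<^bsub>D\<^esub> ?m)"
    "(acounit D X \<star>\<^bsub>D\<^esub> \<one>\<^bsub>D\<^esub> ?A) \<odot>\<^bsub>D\<^esub> ?d = \<one>\<^bsub>D\<^esub> ?A"
    "(\<one>\<^bsub>D\<^esub> ?A \<star>\<^bsub>D\<^esub> acounit D X) \<odot>\<^bsub>D\<^esub> ?d = \<one>\<^bsub>D\<^esub> ?A"
    "(?d \<star>\<^bsub>D\<^esub> \<one>\<^bsub>D\<^esub> ?A) \<odot>\<^bsub>D\<^esub> ?d = (\<one>\<^bsub>D\<^esub> ?A \<star>\<^bsub>D\<^esub> ?d) \<odot>\<^bsub>D\<^esub> ?d"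
    "acounit D X \<odot>\<^bsub>D\<^esub> ?e = \<one>\<^bsub>D\<^esub> \<K>\<^bsub>D\<^esub>"
    "acounit D X \<odot>\<^bsub>D\<^esub> ?m = acounit D X \<star>\<^bsub>D\<^esub> acounit D X"
    "?d \<odot>\<^bsub>D\<^esub> ?e = ?e \<star>\<^bsub>D\<^esub> ?e"
    "?d \<odot>\<^bsub>D\<^esub> ?m = (?m \<star>\<^bsub>D\<^esub> ?m) \<odot>\<^bsub>D\<^esub> (\<one>\<^bsub>D\<^esub> ?A \<star>\<^bsub>D\<^esub> \<gamma>\<^bsub>D\<^esub> ?A ?A \<star>\<^bsub>D\<^esub> \<one>\<^bsub>D\<^esub> ?A) \<odot>\<^bsub>D\<^esub> (?d \<star>\<^bsub>D\<^esub> ?d)"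
    "?m \<odot>\<^bsub>D\<^esub> (aantipode X \<star>\<^bsub>D\<^esub> \<one>\<^bsub>D\<^esub> ?A) \<odot>\<^bsub>D\<^esub> ?d = ?e \<odot>\<^bsub>D\<^esub> acounit D X"
    "?m \<odot>\<^bsub>D\<^esub> (\<one>\<^bsub>D\<^esub> ?A \<star>\<^bsub>D\<^esub> aantipode X) \<odot>\<^bsub>D\<^esub> ?d = ?e \<odot>\<^bsub>D\<^esub> acounit D X"
    using assms unfolding D.hopf_algebra_iff by simp_all
  have unit_left: "(F ?m \<odot> ?t) \<odot> (F ?e \<star> \<one> (Fo ?A)) = \<one> (Fo ?A)"
    by (simp add: F_simps ax)
  have unit_right: "(F ?m \<odot> ?t) \<odot> (\<one> (Fo ?A) \<star> F ?e) = \<one> (Fo ?A)"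
    by (simp add: F_simps ax)
  have assoc: "(F ?m \<odot> ?t) \<odot> ((F ?m \<odot> ?t) \<star> \<one> (Fo ?A)) = (F ?m \<odot> ?t) \<odot> (\<one> (Fo ?A) \<star> (F ?m \<odot> ?t))"
    by (simp add: F_simps ax \<theta>_assoc)
  have counit_left: "(F (acounit D X) \<star> \<one> (Fo ?A)) \<odot> ?t' \<odot> F ?d = \<one> (Fo ?A)"
    by (simp add: F_simps ax)
  have counit_right: "(\<one> (Fo ?A) \<star> F (acounit D X)) \<odot> ?t' \<odot> F ?d = \<one> (Fo ?A)"
    by (simp add: F_simps ax)
  have coassoc: "((?t' \<odot> F ?d) \<star> \<one> (Fo ?A)) \<odot> ?t' \<odot> F ?d = (\<one> (Fo ?A) \<star> (?t' \<odot> F ?d)) \<odot> ?t' \<odot> F ?d"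
    by (simp add: F_simps ax \<theta>'_assoc C.reassoc[OF \<theta>'_assoc])
  have counit_unit: "F (acounit D X) \<odot> F ?e = \<one> \<K>"
    by (simp add: F_simps ax)
  have counit_mult: "F (acounit D X) \<odot> F ?m \<odot> ?t = F (acounit D X) \<star> F (acounit D X)"
    using F_atens_unit(1)[of "acounit D X" "acounit D X"] by (simp add: F_simps ax)
  have comult_unit: "(?t' \<odot> F ?d) \<odot> F ?e = F ?e \<star> F ?e"
    using F_atens_unit(2)[of ?e ?e] by (simp add: F_simps ax)
  have antipode_left: "(F ?m \<odot> ?t) \<odot> (F (aantipode X) \<star> \<one> (Fo ?A)) \<odot> ?t' \<odot> F ?d = F ?e \<odot> F (acounit D X)"
    by (simp add: F_simps ax)
  have antipode_right: "(F ?m \<odot> ?t) \<odot> (\<one> (Fo ?A) \<star> F (aantipode X)) \<odot> ?t' \<odot> F ?d = F ?e \<odot> F (acounit D X)"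
    by (simp add: F_simps ax)
  have comult_mult: "(?t' \<odot> F ?d) \<odot> F ?m \<odot> ?t
      = ((F ?m \<odot> ?t) \<star> (F ?m \<odot> ?t)) \<odot> (\<one> (Fo ?A) \<star> \<gamma> (Fo ?A) (Fo ?A) \<star> \<one> (Fo ?A))
        \<odot> ((?t' \<odot> F ?d) \<star> (?t' \<odot> F ?d))"
  proof -
    let ?g = "\<one>\<^bsub>D\<^esub> ?A \<star>\<^bsub>D\<^esub> \<gamma>\<^bsub>D\<^esub> ?A ?A \<star>\<^bsub>D\<^esub> \<one>\<^bsub>D\<^esub> ?A" and ?c = "\<one> (Fo ?A) \<star> \<gamma> (Fo ?A) (Fo ?A) \<star> \<one> (Fo ?A)"
    let ?AA = "?A \<otimes>\<^bsub>D\<^esub> ?A"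
    have m: "(F ?m \<odot> ?t) \<star> (F ?m \<odot> ?t) = (F ?m \<star> F ?m) \<odot> (?t \<star> ?t)"
      and d: "(?t' \<odot> F ?d) \<star> (?t' \<odot> F ?d) = (?t' \<star> ?t') \<odot> (F ?d \<star> F ?d)"
      by (simp_all add: C.atens_acomp)
    have "((F ?m \<odot> ?t) \<star> (F ?m \<odot> ?t)) \<odot> ?c \<odot> ((?t' \<odot> F ?d) \<star> (?t' \<odot> F ?d))
        = ((F ?m \<star> F ?m) \<odot> (?t \<star> ?t)) \<odot> ?c \<odot> (?t' \<star> ?t') \<odot> (F ?d \<star> F ?d)"
      unfolding m d ..
    \<comment> \<open>Inserting \<open>?t' \<odot> ?t\<close> at the target lets naturality act on
      \<open>F ?m \<star> F ?m\<close> and produces the left-hand side of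
      \<open>\<theta>_interchange\<close>.\<close>
    also have "\<dots> = ?t' \<odot> (?t \<odot> (F ?m \<star> F ?m)) \<odot> (?t \<star> ?t) \<odot> ?c \<odot> (?t' \<star> ?t') \<odot> (F ?d \<star> F ?d)"
      by simp
    also have "\<dots> = ?t' \<odot> F (?m \<star>\<^bsub>D\<^esub> ?m) \<odot> (\<theta> ?AA ?AA \<odot> (?t \<star> ?t) \<odot> ?c) \<odot> (?t' \<star> ?t') \<odot> (F ?d \<star> F ?d)"
      by (simp add: \<theta>_nats)
    \<comment> \<open>After the braiding has moved past it, \<open>?t \<star> ?t\<close> stands next
      to its inverse.\<close>
    also have "\<dots> = ?t' \<odot> F (?m \<star>\<^bsub>D\<^esub> ?m) \<odot> F ?g \<odot> \<theta> ?AA ?AA \<odot> ((?t \<star> ?t) \<odot> (?t' \<star> ?t')) \<odot> (F ?d \<star> F ?d)"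
      by (subst \<theta>_interchange) simp_all
    also have "\<dots> = ?t' \<odot> F (?m \<star>\<^bsub>D\<^esub> ?m) \<odot> F ?g \<odot> \<theta> ?AA ?AA \<odot> (F ?d \<star> F ?d)"
      by (subst C.atens_acomp) simp_all
    also have "\<dots> = ?t' \<odot> F ((?m \<star>\<^bsub>D\<^esub> ?m) \<odot>\<^bsub>D\<^esub> ?g \<odot>\<^bsub>D\<^esub> (?d \<star>\<^bsub>D\<^esub> ?d)) \<odot> ?t"
      by (simp add: F_simps)
    also have "\<dots> = (?t' \<odot> F ?d) \<odot> F ?m \<odot> ?t"
      by (simp add: F_simps flip: ax(10))
    finally show ?thesis ..
  qed
  show ?thesis
    unfolding C.hopf_algebra_iff
    using unit_left unit_right assoc counit_left counit_right coassoc counit_unit counit_mult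
      comult_unit comult_mult antipode_left antipode_right
    by simp
qed

lemma bracoid_image_arrow:
  assumes "carrier H \<in> Obj D" "carrier B \<in> Obj D"
  shows "aaction C (bracoid_image (H, B, \<phi>)) = F (aaction D (H, B, \<phi>)) \<odot> \<theta> (carrier H) (carrier B)"
  using assms by (simp add: arrow_eq_iff bracoid_image_def)

text \<open>Phi is a composite of structure morphisms, so a functor preserves it up to comparisons;
  the comparison coming from the comultiplication is the one that does not cancel at once.\<close>

lemma aPhi_image:
  assumes "hopf_algebra D H" "hopf_algebra D B" "arr D (aaction D (H, B, \<phi>))"
  shows "aPhi C (bracoid_image (H, B, \<phi>)) = F (aPhi D (H, B, \<phi>)) \<odot> \<theta> (carrier H) (carrier B)"
proof -
  note [simp] = D.hopf_arr[OF assms(1)] D.hopf_arr[OF assms(2)] assms(3)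
    hopf_image_arrows[OF D.hopf_arr(1)[OF assms(1)]] hopf_image_arrows[OF D.hopf_arr(1)[OF assms(2)]]
  let ?H = "carrier H" and ?B = "carrier B" and ?a = "aaction D (H, B, \<phi>)"
  let ?u = "aantipode B \<odot>\<^bsub>D\<^esub> ?a \<odot>\<^bsub>D\<^esub> (\<one>\<^bsub>D\<^esub> ?H \<star>\<^bsub>D\<^esub> aunit D B)"
  \<comment> \<open>The unit of \<open>B\<close> starts at the unit object, where the comparison is
    an identity, so no \<open>\<theta>\<close> survives.\<close>
  have u: "F (aantipode B) \<odot> (F ?a \<odot> \<theta> ?H ?B) \<odot> (\<one> (Fo ?H) \<star> F (aunit D B)) = F ?u"
    by (simp add: F_simps)
  have "F ?u \<star> (F ?a \<odot> \<theta> ?H ?B) = (F ?u \<star> F ?a) \<odot> (\<one> (Fo ?H) \<star> \<theta> ?H ?B)"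
    by (subst C.atens_acomp) simp_all
  then have "aPhi C (bracoid_image (H, B, \<phi>)) = (F (amult D B) \<odot> \<theta> ?B ?B)
      \<odot> ((F ?u \<star> F ?a) \<odot> (\<one> (Fo ?H) \<star> \<theta> ?H ?B)) \<odot> ((\<theta>' ?H ?H \<odot> F (acomult D H)) \<star> \<one> (Fo ?B))"
    using bracoid_image_arrow[of H B \<phi>] u by (simp add: aPhi_def bracoid_image_def)
  also have "\<dots> = F (amult D B \<odot>\<^bsub>D\<^esub> (?u \<star>\<^bsub>D\<^esub> ?a))
      \<odot> (\<theta> ?H (?H \<otimes>\<^bsub>D\<^esub> ?B) \<odot> (\<one> (Fo ?H) \<star> \<theta> ?H ?B))
      \<odot> (\<theta>' ?H ?H \<star> \<one> (Fo ?B)) \<odot> (F (acomult D H) \<star> \<one> (Fo ?B))"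
    by (simp add: F_simps)
  \<comment> \<open>\<open>\<theta>' ?H ?H\<close> compares the two copies of \<open>?H\<close>,
    whereas the other comparisons group the second copy with \<open>?B\<close>. Associativity
    regroups them and allows the cancellation.\<close>
  also have "\<dots> = F (amult D B \<odot>\<^bsub>D\<^esub> (?u \<star>\<^bsub>D\<^esub> ?a))
      \<odot> \<theta> (?H \<otimes>\<^bsub>D\<^esub> ?H) ?B \<odot> ((\<theta> ?H ?H \<odot> \<theta>' ?H ?H) \<star> \<one> (Fo ?B)) \<odot> (F (acomult D H) \<star> \<one> (Fo ?B))"
    by (subst \<theta>_assoc[symmetric]) (simp_all add: C.whisker_right del: \<theta>_\<theta>')
  also have "\<dots> = F (aPhi D (H, B, \<phi>)) \<odot> \<theta> ?H ?B"
    by (simp add: F_simps aPhi_def)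
  finally show ?thesis .
qed

lemma hopf_bracoid_image:
  assumes "hopf_bracoid D (H, B, \<phi>)"
  shows "hopf_bracoid C (bracoid_image (H, B, \<phi>))"
proof -
  have hopf: "hopf_algebra D H" "hopf_algebra D B" and a [simp]: "arr D (aaction D (H, B, \<phi>))"
    using assms unfolding D.hopf_bracoid_iff by simp_all
  let ?H = "carrier H" and ?B = "carrier B" and ?a = "aaction D (H, B, \<phi>)" and ?p = "aPhi D (H, B, \<phi>)"
  let ?m = "amult D B" and ?d = "acomult D H" and ?t = "\<theta> ?H ?B"
  have ax: "?a \<odot>\<^bsub>D\<^esub> (aunit D H \<star>\<^bsub>D\<^esub> \<one>\<^bsub>D\<^esub> ?B) = \<one>\<^bsub>D\<^esub> ?B"
    "?a \<odot>\<^bsub>D\<^esub> (\<one>\<^bsub>D\<^esub> ?H \<star>\<^bsub>D\<^esub> ?a) = ?a \<odot>\<^bsub>D\<^esub> (amult D H \<star>\<^bsub>D\<^esub> \<one>\<^bsub>D\<^esub> ?B)"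
    "?a \<odot>\<^bsub>D\<^esub> (\<one>\<^bsub>D\<^esub> ?H \<star>\<^bsub>D\<^esub> ?m) = ?m \<odot>\<^bsub>D\<^esub> (?a \<star>\<^bsub>D\<^esub> ?p)
      \<odot>\<^bsub>D\<^esub> (\<one>\<^bsub>D\<^esub> ?H \<star>\<^bsub>D\<^esub> \<gamma>\<^bsub>D\<^esub> ?H ?B \<star>\<^bsub>D\<^esub> \<one>\<^bsub>D\<^esub> ?B) \<odot>\<^bsub>D\<^esub> (?d \<star>\<^bsub>D\<^esub> \<one>\<^bsub>D\<^esub> (?B \<otimes>\<^bsub>D\<^esub> ?B))"
    using assms unfolding D.hopf_bracoid_iff by simp_all
  note [simp] = D.hopf_arr[OF hopf(1)] D.hopf_arr[OF hopf(2)]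
    hopf_image_arrows[OF D.hopf_arr(1)[OF hopf(1)]] hopf_image_arrows[OF D.hopf_arr(1)[OF hopf(2)]]
  have [simp]: "arr D ?p" "src ?p = ?H \<otimes>\<^bsub>D\<^esub> ?B" "tgt ?p = ?B"
    by (simp_all add: aPhi_def)
  have unit: "(F ?a \<odot> ?t) \<odot> (F (aunit D H) \<star> \<one> (Fo ?B)) = \<one> (Fo ?B)"
    by (simp add: F_simps ax)
  have assoc: "(F ?a \<odot> ?t) \<odot> (\<one> (Fo ?H) \<star> (F ?a \<odot> ?t))
      = (F ?a \<odot> ?t) \<odot> ((F (amult D H) \<odot> \<theta> ?H ?H) \<star> \<one> (Fo ?B))"
    by (simp add: F_simps ax \<theta>_assoc)
  let ?c = "\<one> (Fo ?H) \<star> \<gamma> (Fo ?H) (Fo ?B) \<star> \<one> (Fo ?B)"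
  let ?g = "\<one>\<^bsub>D\<^esub> ?H \<star>\<^bsub>D\<^esub> \<gamma>\<^bsub>D\<^esub> ?H ?B \<star>\<^bsub>D\<^esub> \<one>\<^bsub>D\<^esub> ?B"
  let ?HB = "?H \<otimes>\<^bsub>D\<^esub> ?B" and ?HH = "?H \<otimes>\<^bsub>D\<^esub> ?H" and ?BB = "?B \<otimes>\<^bsub>D\<^esub> ?B"
  let ?dt = "(\<theta>' ?H ?H \<odot> F ?d) \<star> \<one> (Fo ?B \<otimes> Fo ?B)"
  \<comment> \<open>\<open>\<theta>_interchange\<close> leaves
    \<open>\<theta> ?H ?H \<star> \<theta> ?B ?B\<close>: the first factor cancels against the
    comultiplication of \<open>H\<close>, the second is the comparison that the product of
    \<open>B\<close> requires on the other side of the law.\<close>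
  have dt: "(\<theta> ?H ?H \<star> \<theta> ?B ?B) \<odot> ?dt = (F ?d \<star> \<one> (Fo ?BB)) \<odot> (\<one> (Fo ?H) \<star> \<theta> ?B ?B)"
    by (simp add: C.atens_acomp)
  have "(F ?m \<odot> \<theta> ?B ?B) \<odot> ((F ?a \<odot> ?t) \<star> (F ?p \<odot> ?t)) \<odot> ?c \<odot> ?dt
      = (F ?m \<odot> \<theta> ?B ?B) \<odot> ((F ?a \<star> F ?p) \<odot> (?t \<star> ?t)) \<odot> ?c \<odot> ?dt"
    by (subst C.atens_acomp) simp_all
  also have "\<dots> = F (?m \<odot>\<^bsub>D\<^esub> (?a \<star>\<^bsub>D\<^esub> ?p)) \<odot> (\<theta> ?HB ?HB \<odot> (?t \<star> ?t) \<odot> ?c) \<odot> ?dt"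
    by (simp add: F_simps)
  also have "\<dots> = F (?m \<odot>\<^bsub>D\<^esub> (?a \<star>\<^bsub>D\<^esub> ?p) \<odot>\<^bsub>D\<^esub> ?g) \<odot> \<theta> ?HH ?BB \<odot> ((\<theta> ?H ?H \<star> \<theta> ?B ?B) \<odot> ?dt)"
    by (subst \<theta>_interchange) (simp_all add: F_acomp F_acomp_reassoc)
  also have "\<dots> = F (?a \<odot>\<^bsub>D\<^esub> (\<one>\<^bsub>D\<^esub> ?H \<star>\<^bsub>D\<^esub> ?m)) \<odot> \<theta> ?H ?BB \<odot> (\<one> (Fo ?H) \<star> \<theta> ?B ?B)"
    unfolding dt ax(3) by (simp add: F_simps)
  also have "\<dots> = (F ?a \<odot> ?t) \<odot> (\<one> (Fo ?H) \<star> (F ?m \<odot> \<theta> ?B ?B))"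
    by (simp add: F_simps)
  finally have brace: "(F ?a \<odot> ?t) \<odot> (\<one> (Fo ?H) \<star> (F ?m \<odot> \<theta> ?B ?B))
      = (F ?m \<odot> \<theta> ?B ?B) \<odot> ((F ?a \<odot> ?t) \<star> (F ?p \<odot> ?t)) \<odot> ?c \<odot> ?dt" ..
  show ?thesis
    using unit assoc brace hopf_algebra_image[OF hopf(1)] hopf_algebra_image[OF hopf(2)]
      bracoid_image_arrow[of H B \<phi>] aPhi_image[OF hopf a]
    unfolding bracoid_image_def by (simp add: C.hopf_bracoid_iff)
qed

end

section \<open>Products of symmetric monoidal categories\<close>

definition prod_cat ::
  "('o, 'm, 'x) braided_cat_scheme \<Rightarrow> ('p, 'n, 'y) braided_cat_scheme \<Rightarrow> ('o \<times> 'p, 'm \<times> 'n) braided_cat" where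
  "prod_cat C D =
     \<lparr>Obj = Obj C \<times> Obj D,
      Hom = (\<lambda>(P, P') (Q, Q'). Hom C P Q \<times> Hom D P' Q'),
      Id = (\<lambda>(P, P'). (\<iota>\<^bsub>C\<^esub> P, \<iota>\<^bsub>D\<^esub> P')),
      Comp = (\<lambda>(g, g') (f, f'). (g \<cdot>\<^bsub>C\<^esub> f, g' \<cdot>\<^bsub>D\<^esub> f')),
      tensor_obj = (\<lambda>(P, P') (Q, Q'). (P \<otimes>\<^bsub>C\<^esub> Q, P' \<otimes>\<^bsub>D\<^esub> Q')),
      tensor_arr = (\<lambda>(f, f') (g, g'). (f \<boxtimes>\<^bsub>C\<^esub> g, f' \<boxtimes>\<^bsub>D\<^esub> g')),
      unit_obj = (\<K>\<^bsub>C\<^esub>, \<K>\<^bsub>D\<^esub>),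
      associator = (\<lambda>(P, P') (Q, Q') (R, R'). (\<alpha>\<^bsub>C\<^esub> P Q R, \<alpha>\<^bsub>D\<^esub> P' Q' R')),
      left_unitor = (\<lambda>(P, P'). (\<ll>\<^bsub>C\<^esub> P, \<ll>\<^bsub>D\<^esub> P')),
      right_unitor = (\<lambda>(P, P'). (\<rr>\<^bsub>C\<^esub> P, \<rr>\<^bsub>D\<^esub> P')),
      braiding = (\<lambda>(P, P') (Q, Q'). (\<c>\<^bsub>C\<^esub> P Q, \<c>\<^bsub>D\<^esub> P' Q'))\<rparr>"

lemma prod_cat_simps [simp]:
  "Obj (prod_cat C D) = Obj C \<times> Obj D"
  "Hom (prod_cat C D) (P, P') (Q, Q') = Hom C P Q \<times> Hom D P' Q'"
  "\<iota>\<^bsub>prod_cat C D\<^esub> (P, P') = (\<iota>\<^bsub>C\<^esub> P, \<iota>\<^bsub>D\<^esub> P')"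
  "(g, g') \<cdot>\<^bsub>prod_cat C D\<^esub> (f, f') = (g \<cdot>\<^bsub>C\<^esub> f, g' \<cdot>\<^bsub>D\<^esub> f')"
  "(P, P') \<otimes>\<^bsub>prod_cat C D\<^esub> (Q, Q') = (P \<otimes>\<^bsub>C\<^esub> Q, P' \<otimes>\<^bsub>D\<^esub> Q')"
  "(f, f') \<boxtimes>\<^bsub>prod_cat C D\<^esub> (g, g') = (f \<boxtimes>\<^bsub>C\<^esub> g, f' \<boxtimes>\<^bsub>D\<^esub> g')"
  "\<K>\<^bsub>prod_cat C D\<^esub> = (\<K>\<^bsub>C\<^esub>, \<K>\<^bsub>D\<^esub>)"
  "\<alpha>\<^bsub>prod_cat C D\<^esub> (P, P') (Q, Q') (R, R') = (\<alpha>\<^bsub>C\<^esub> P Q R, \<alpha>\<^bsub>D\<^esub> P' Q' R')"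
  "\<ll>\<^bsub>prod_cat C D\<^esub> (P, P') = (\<ll>\<^bsub>C\<^esub> P, \<ll>\<^bsub>D\<^esub> P')"
  "\<rr>\<^bsub>prod_cat C D\<^esub> (P, P') = (\<rr>\<^bsub>C\<^esub> P, \<rr>\<^bsub>D\<^esub> P')"
  "\<c>\<^bsub>prod_cat C D\<^esub> (P, P') (Q, Q') = (\<c>\<^bsub>C\<^esub> P Q, \<c>\<^bsub>D\<^esub> P' Q')"
  by (simp_all add: prod_cat_def)

lemma inverse_arrows_prod:
  "inverse_arrows (prod_cat C D) (P, P') (Q, Q') (f, f') (g, g')
    \<longleftrightarrow> inverse_arrows C P Q f g \<and> inverse_arrows D P' Q' f' g'"
  by (auto simp: inverse_arrows_def)

lemma isomorphism_prod:
  "isomorphism (prod_cat C D) (P, P') (Q, Q') (f, f')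
    \<longleftrightarrow> isomorphism C P Q f \<and> isomorphism D P' Q' f'"
  by (auto simp: isomorphism_def inverse_arrows_prod)

lemma strict_symmetric_category_prod:
  assumes "strict_symmetric_category C" and "strict_symmetric_category D"
  shows "strict_symmetric_category (prod_cat C D)"
proof -
  \<comment> \<open>Interpreting the parents rather than \<open>strict_symmetric_category\<close>
    keeps its simp rules out, so that the goals retain the shape of the axioms.\<close>
  interpret C: strict_monoidal_category C
    using assms(1) by (rule strict_symmetric_category.axioms)
  interpret C: symmetric_monoidal_category C
    using assms(1) by (rule strict_symmetric_category.axioms)
  interpret D: strict_monoidal_category D
    using assms(2) by (rule strict_symmetric_category.axioms)
  interpret D: symmetric_monoidal_category D
    using assms(2) by (rule strict_symmetric_category.axioms)
  show ?thesis
    by (unfold_locales; clarsimp simp: isomorphism_prod inverse_arrows_prod; (intro conjI)?;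
        (rule C.Id_Hom C.Comp_Hom C.Id_left C.Id_right C.Comp_assoc C.unit_Obj C.tensor_Obj
          C.tensor_Hom C.tensor_Id C.tensor_Comp C.associator_iso C.associator_natural
          C.left_unitor_iso C.left_unitor_natural C.right_unitor_iso C.right_unitor_natural
          C.pentagon C.triangle C.strict_assoc C.strict_left_unit C.strict_right_unit
          C.associator_Id C.left_unitor_Id C.right_unitor_Id C.braiding_iso C.braiding_natural
          C.hexagon_right C.hexagon_left C.symmetry
          D.Id_Hom D.Comp_Hom D.Id_left D.Id_right D.Comp_assoc D.unit_Obj D.tensor_Obj
          D.tensor_Hom D.tensor_Id D.tensor_Comp D.associator_iso D.associator_natural
          D.left_unitor_iso D.left_unitor_natural D.right_unitor_iso D.right_unitor_natural
          D.pentagon D.triangle D.strict_assoc D.strict_left_unit D.strict_right_unit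
          D.associator_Id D.left_unitor_Id D.right_unitor_Id D.braiding_iso D.braiding_natural
          D.hexagon_right D.hexagon_left D.symmetry; assumption))
qed

section \<open>The tensor product as a symmetric monoidal functor\<close>

definition interchange ::
  "('o, 'm, 'x) braided_cat_scheme \<Rightarrow> 'o \<Rightarrow> 'o \<Rightarrow> 'o \<Rightarrow> 'o \<Rightarrow> ('o, 'm) arrow" ("\<chi>\<index>") where
  "interchange C P P' Q Q' = \<one>\<^bsub>C\<^esub> P \<star>\<^bsub>C\<^esub> \<gamma>\<^bsub>C\<^esub> P' Q \<star>\<^bsub>C\<^esub> \<one>\<^bsub>C\<^esub> Q'"

context strict_symmetric_category
begin

lemma interchange_arr [simp]:
  assumes "P \<in> Obj C" "P' \<in> Obj C" "Q \<in> Obj C" "Q' \<in> Obj C"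
  shows "arr C (\<chi> P P' Q Q')" "src (\<chi> P P' Q Q') = P \<otimes> P' \<otimes> Q \<otimes> Q'"
    "tgt (\<chi> P P' Q Q') = P \<otimes> Q \<otimes> P' \<otimes> Q'"
  using assms by (simp_all add: interchange_def)

text \<open>Here symmetry enters: the braiding of the middle factors is undone by the braiding of
  the swapped ones.\<close>

lemma interchange_interchange [simp]:
  "\<lbrakk>P \<in> Obj C; P' \<in> Obj C; Q \<in> Obj C; Q' \<in> Obj C\<rbrakk>
    \<Longrightarrow> \<chi> P Q P' Q' \<odot> \<chi> P P' Q Q' = \<one> (P \<otimes> P' \<otimes> Q \<otimes> Q')"
  by (simp add: interchange_def atens_acomp)

lemma interchange_interchange_reassoc [simp]:
  "\<lbrakk>P \<in> Obj C; P' \<in> Obj C; Q \<in> Obj C; Q' \<in> Obj C; arr C f; tgt f = P \<otimes> P' \<otimes> Q \<otimes> Q'\<rbrakk>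
    \<Longrightarrow> \<chi> P Q P' Q' \<odot> \<chi> P P' Q Q' \<odot> f = f"
  by (subst acomp_assoc[symmetric]) simp_all

lemma interchange_unit [simp]:
  assumes "P \<in> Obj C" "P' \<in> Obj C"
  shows "\<chi> \<K> \<K> P P' = \<one> (P \<otimes> P')" "\<chi> P P' \<K> \<K> = \<one> (P \<otimes> P')"
  using assms by (simp_all add: interchange_def)

text \<open>Only the middle pair moves, so this is naturality of the braiding there.
  \<open>atens_assoc\<close> is withheld to keep that pair bracketed.\<close>

lemma interchange_natural:
  assumes "arr C f" "arr C f'" "arr C g" "arr C g'"
    and [simp]: "P = tgt f" "P' = tgt f'" "Q = tgt g" "Q' = tgt g'"
  shows "\<chi> P P' Q Q' \<odot> (f \<star> f' \<star> g \<star> g') = (f \<star> g \<star> f' \<star> g') \<odot> \<chi> (src f) (src f') (src g) (src g')"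
proof -
  note [simp] = assms(1-4)
  have "\<chi> P P' Q Q' \<odot> (f \<star> (f' \<star> g) \<star> g') = f \<star> (\<gamma> P' Q \<odot> (f' \<star> g)) \<star> g'"
    by (simp add: interchange_def atens_acomp del: atens_assoc)
  also have "\<dots> = f \<star> ((g \<star> f') \<odot> \<gamma> (src f') (src g)) \<star> g'"
    by (simp add: abraid_natural)
  also have "\<dots> = (f \<star> (g \<star> f') \<star> g') \<odot> \<chi> (src f) (src f') (src g) (src g')"
    by (simp add: interchange_def atens_acomp del: atens_assoc)
  finally show ?thesis
    by simp
qed

lemma exchange:
  "\<lbrakk>arr C f; arr C g\<rbrakk> \<Longrightarrow> (\<one> (tgt f) \<star> g) \<odot> (f \<star> \<one> (src g)) = (f \<star> \<one> (tgt g)) \<odot> (\<one> (src f) \<star> g)"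
  by (simp add: atens_acomp)

text \<open>The hexagons split both sides into the same three crossings.
  \<open>\<gamma> P' R\<close> comes last on either side; \<open>\<gamma> P' Q\<close> and
  \<open>\<gamma> Q' R\<close> act on disjoint factors, so their order may be exchanged.\<close>

lemma interchange_assoc:
  assumes [simp]: "P \<in> Obj C" "P' \<in> Obj C" "Q \<in> Obj C" "Q' \<in> Obj C" "R \<in> Obj C" "R' \<in> Obj C"
  shows "\<chi> (P \<otimes> Q) (P' \<otimes> Q') R R' \<odot> (\<chi> P P' Q Q' \<star> \<one> (R \<otimes> R'))
    = \<chi> P P' (Q \<otimes> R) (Q' \<otimes> R') \<odot> (\<one> (P \<otimes> P') \<star> \<chi> Q Q' R R')"
  using exchange[of "\<one> P \<star> \<gamma> P' Q" "\<gamma> Q' R \<star> \<one> R'"]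
  by (simp add: interchange_def abraid_tensor_left abraid_tensor_right whisker_left whisker_right)

text \<open>The hexagons split the braiding of two pairs into four crossings:
  \<open>\<gamma> P' Q\<close> comes first and \<open>\<gamma> P Q'\<close> last, and these two are
  the interchanges.\<close>

lemma abraid_tensor:
  assumes [simp]: "P \<in> Obj C" "P' \<in> Obj C" "Q \<in> Obj C" "Q' \<in> Obj C"
  shows "\<gamma> (P \<otimes> P') (Q \<otimes> Q') = \<chi> Q P Q' P' \<odot> (\<gamma> P Q \<star> \<gamma> P' Q') \<odot> \<chi> P P' Q Q'"
proof -
  have "\<gamma> P Q \<star> \<gamma> P' Q' = (\<one> (Q \<otimes> P) \<star> \<gamma> P' Q') \<odot> (\<gamma> P Q \<star> \<one> (P' \<otimes> Q'))"
    by (simp add: atens_acomp)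
  then show ?thesis
    by (simp add: interchange_def abraid_tensor_left abraid_tensor_right whisker_left whisker_right)
qed

text \<open>Cancelling either interchange in \<open>abraid_tensor\<close> gives the two forms. The
  first is the compatibility of the tensor functor with braidings, the second serves products and
  actions.\<close>

lemma interchange_braid:
  assumes [simp]: "P \<in> Obj C" "P' \<in> Obj C" "Q \<in> Obj C" "Q' \<in> Obj C"
  shows "\<chi> Q Q' P P' \<odot> \<gamma> (P \<otimes> P') (Q \<otimes> Q') = (\<gamma> P Q \<star> \<gamma> P' Q') \<odot> \<chi> P P' Q Q'"
    and "\<gamma> (P \<otimes> P') (Q \<otimes> Q') \<odot> \<chi> P Q P' Q' = \<chi> Q P Q' P' \<odot> (\<gamma> P Q \<star> \<gamma> P' Q')"
  by (simp_all add: abraid_tensor)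

end

lemma prod_cat_sel [simp]:
  "P \<in> Obj (prod_cat C D) \<longleftrightarrow> fst P \<in> Obj C \<and> snd P \<in> Obj D"
  "P \<otimes>\<^bsub>prod_cat C D\<^esub> Q = (fst P \<otimes>\<^bsub>C\<^esub> fst Q, snd P \<otimes>\<^bsub>D\<^esub> snd Q)"
  "h \<cdot>\<^bsub>prod_cat C D\<^esub> k = (fst h \<cdot>\<^bsub>C\<^esub> fst k, snd h \<cdot>\<^bsub>D\<^esub> snd k)"
  "h \<boxtimes>\<^bsub>prod_cat C D\<^esub> k = (fst h \<boxtimes>\<^bsub>C\<^esub> fst k, snd h \<boxtimes>\<^bsub>D\<^esub> snd k)"
  "\<iota>\<^bsub>prod_cat C D\<^esub> P = (\<iota>\<^bsub>C\<^esub> (fst P), \<iota>\<^bsub>D\<^esub> (snd P))"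
  "\<c>\<^bsub>prod_cat C D\<^esub> P Q = (\<c>\<^bsub>C\<^esub> (fst P) (fst Q), \<c>\<^bsub>D\<^esub> (snd P) (snd Q))"
  by (simp_all add: prod_cat_def split_beta mem_Times_iff)

definition afst :: "('o \<times> 'p, 'm \<times> 'n) arrow \<Rightarrow> ('o, 'm) arrow" where
  "afst f = Arrow (fst (src f)) (fst (und f)) (fst (tgt f))"

definition asnd :: "('o \<times> 'p, 'm \<times> 'n) arrow \<Rightarrow> ('p, 'n) arrow" where
  "asnd f = Arrow (snd (src f)) (snd (und f)) (snd (tgt f))"

lemma afst_asnd_sel [simp]:
  "src (afst f) = fst (src f)" "und (afst f) = fst (und f)" "tgt (afst f) = fst (tgt f)"
  "src (asnd f) = snd (src f)" "und (asnd f) = snd (und f)" "tgt (asnd f) = snd (tgt f)"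
  by (simp_all add: afst_def asnd_def)

lemma arr_prod: "arr (prod_cat C D) f \<longleftrightarrow> arr C (afst f) \<and> arr D (asnd f)"
  by (cases "src f"; cases "tgt f"; cases "und f") (auto simp: arr_def)

lemma afst_asnd_simps [simp]:
  "afst (acomp (prod_cat C D) f g) = acomp C (afst f) (afst g)"
  "asnd (acomp (prod_cat C D) f g) = acomp D (asnd f) (asnd g)"
  "afst (atens (prod_cat C D) f g) = atens C (afst f) (afst g)"
  "asnd (atens (prod_cat C D) f g) = atens D (asnd f) (asnd g)"
  "afst (aid (prod_cat C D) P) = aid C (fst P)"
  "asnd (aid (prod_cat C D) P) = aid D (snd P)"
  "afst (abraid (prod_cat C D) P Q) = abraid C (fst P) (fst Q)"
  "asnd (abraid (prod_cat C D) P Q) = abraid D (snd P) (snd Q)"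
  by (simp_all add: arrow_eq_iff)

context strict_symmetric_category
begin

text \<open>The inverse comparison is again an interchange, with the middle arguments swapped. The
  unit laws hold because a braiding with \<open>\<K>\<close> is an identity.\<close>

lemma strict_symmetric_functor_tensor:
  "strict_symmetric_functor (prod_cat C C) C (\<lambda>P. fst P \<otimes> snd P) (\<lambda>f. afst f \<star> asnd f)
     (\<lambda>P Q. \<chi> (fst P) (snd P) (fst Q) (snd Q)) (\<lambda>P Q. \<chi> (fst P) (fst Q) (snd P) (snd Q))"
proof -
  interpret P: strict_symmetric_category "prod_cat C C"
    by (rule strict_symmetric_category_prod) unfold_locales
  show ?thesis
    by (unfold_locales;
        simp add: mem_Times_iff arr_prod atens_acomp interchange_natural interchange_assoc interchange_braid)
qed

end

section \<open>Tensor products of Hopf bracoids\<close>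

definition hopf_pair :: "('o, 'm) hopf \<Rightarrow> ('p, 'n) hopf \<Rightarrow> ('o \<times> 'p, 'm \<times> 'n) hopf" where
  "hopf_pair X Y =
     \<lparr>carrier = (carrier X, carrier Y), unit = (\<eta> X, \<eta> Y), mult = (\<mu> X, \<mu> Y),
      counit = (\<epsilon> X, \<epsilon> Y), comult = (\<delta> X, \<delta> Y), antipode = (\<lambda>\<^sub>S X, \<lambda>\<^sub>S Y)\<rparr>"

text \<open>All operations of \<open>prod_cat\<close> act on the two components separately, so
  unfolding the raw definitions is enough.\<close>

lemma hopf_algebra_pair:
  "\<lbrakk>hopf_algebra C X; hopf_algebra D Y\<rbrakk> \<Longrightarrow> hopf_algebra (prod_cat C D) (hopf_pair X Y)"
  by (simp add: hopf_algebra_def hopf_pair_def algebra_def coalgebra_def algebra_morphism_def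
      tensor_mult_def Let_def)

lemma hopf_bracoid_pair:
  "\<lbrakk>hopf_bracoid C (H, B, \<phi>); hopf_bracoid D (A, E, \<psi>)\<rbrakk>
    \<Longrightarrow> hopf_bracoid (prod_cat C D) (hopf_pair H A, hopf_pair B E, (\<phi>, \<psi>))"
  using hopf_algebra_pair[of C H D A] hopf_algebra_pair[of C B D E]
  by (simp add: hopf_bracoid_def left_module_def bracoid_Phi_def bracoid_u_def)
    (simp add: hopf_pair_def)

lemma carrier_hopf_tensor [simp]: "carrier (hopf_tensor C X Y) = carrier X \<otimes>\<^bsub>C\<^esub> carrier Y"
  by (simp add: hopf_tensor_def)

text \<open>Reduces equality of records to equality of typed arrows, to which the calculus above
  applies.\<close>

lemma hopf_eqI:
  fixes X Y :: "('o, 'm) hopf"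
  assumes "carrier X = carrier Y" "aunit C X = aunit C Y" "amult C X = amult C Y"
    "acounit C X = acounit C Y" "acomult C X = acomult C Y" "aantipode X = aantipode Y"
  shows "X = Y"
  using assms by (intro hopf.equality) (simp_all add: arrow_eq_iff)

context strict_symmetric_category
begin

lemma hopf_algebra_tensor:
    "\<lbrakk>hopf_algebra C X; hopf_algebra C Y\<rbrakk> \<Longrightarrow> hopf_algebra C (hopf_tensor C X Y)"
  and hopf_bracoid_tensor:
    "\<lbrakk>hopf_bracoid C V; hopf_bracoid C W\<rbrakk> \<Longrightarrow> hopf_bracoid C (bracoid_tensor C V W)"
proof -
  interpret T: strict_symmetric_functor "prod_cat C C" C "\<lambda>P. fst P \<otimes> snd P" "\<lambda>f. afst f \<star> asnd f"
     "\<lambda>P Q. \<chi> (fst P) (snd P) (fst Q) (snd Q)" "\<lambda>P Q. \<chi> (fst P) (fst Q) (snd P) (snd Q)"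
    by (rule strict_symmetric_functor_tensor)
  \<comment> \<open>The braidings in \<open>tensor_mult\<close> and \<open>tensor_comult\<close> are
    exactly the comparison and its inverse at the pair of carriers, so the two records agree by
    unfolding.\<close>
  have hopf: "T.hopf_image (hopf_pair X Y) = hopf_tensor C X Y" for X Y
    unfolding T.hopf_image_def
    by (simp add: hopf_tensor_def hopf_pair_def tensor_mult_def tensor_comult_def interchange_def)
  show "hopf_algebra C (hopf_tensor C X Y)" if "hopf_algebra C X" "hopf_algebra C Y"
    using T.hopf_algebra_image[OF hopf_algebra_pair[OF that]] unfolding hopf .
  show "hopf_bracoid C (bracoid_tensor C V W)" if VW: "hopf_bracoid C V" "hopf_bracoid C W"
  proof -
    obtain H B \<phi> A D \<psi> where eq: "V = (H, B, \<phi>)" "W = (A, D, \<psi>)"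
      by (cases V, cases W) auto
    have "T.bracoid_image (hopf_pair H A, hopf_pair B D, (\<phi>, \<psi>)) = bracoid_tensor C V W"
      unfolding T.bracoid_image_def eq
      by (simp add: bracoid_tensor_def hopf) (simp add: hopf_pair_def interchange_def)
    with T.hopf_bracoid_image[OF hopf_bracoid_pair[OF VW[unfolded eq]]] show ?thesis
      by (simp only:)
  qed
qed

lemma hopf_tensor_arrows:
  assumes "carrier X \<in> Obj C" "carrier Y \<in> Obj C"
  shows "aunit C (hopf_tensor C X Y) = aunit C X \<star> aunit C Y"
    and "amult C (hopf_tensor C X Y)
      = (amult C X \<star> amult C Y) \<odot> \<chi> (carrier X) (carrier Y) (carrier X) (carrier Y)"
    and "acounit C (hopf_tensor C X Y) = acounit C X \<star> acounit C Y"
    and "acomult C (hopf_tensor C X Y)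
      = \<chi> (carrier X) (carrier X) (carrier Y) (carrier Y) \<odot> (acomult C X \<star> acomult C Y)"
    and "aantipode (hopf_tensor C X Y) = aantipode X \<star> aantipode Y"
  using assms
  by (simp_all add: arrow_eq_iff hopf_tensor_def tensor_mult_def tensor_comult_def interchange_def)

lemma bracoid_tensor_arrow:
  assumes "carrier H \<in> Obj C" "carrier B \<in> Obj C" "carrier A \<in> Obj C" "carrier D \<in> Obj C"
  shows "aaction C (bracoid_tensor C (H, B, \<phi>) (A, D, \<psi>))
    = (aaction C (H, B, \<phi>) \<star> aaction C (A, D, \<psi>)) \<odot> \<chi> (carrier H) (carrier A) (carrier B) (carrier D)"
  using assms by (simp add: arrow_eq_iff bracoid_tensor_def interchange_def)

section \<open>Strict unit and associativity laws for tensor products of Hopf algebras and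
  bracoids\<close>

lemma hopf_unit_arrows:
  "carrier (hopf_unit C) = \<K>" "aunit C (hopf_unit C) = \<one> \<K>" "amult C (hopf_unit C) = \<one> \<K>"
  "acounit C (hopf_unit C) = \<one> \<K>" "acomult C (hopf_unit C) = \<one> \<K>"
  "aantipode (hopf_unit C) = \<one> \<K>"
  by (simp_all add: arrow_eq_iff hopf_unit_def)

lemma hopf_algebra_unit: "hopf_algebra C (hopf_unit C)"
  by (simp add: hopf_algebra_iff hopf_unit_arrows)

lemma hopf_bracoid_unit: "hopf_bracoid C (hopf_unit C, hopf_unit C, \<iota> \<K>)"
proof -
  have a: "aaction C (hopf_unit C, hopf_unit C, \<iota> \<K>) = \<one> \<K>"
    by (simp add: arrow_eq_iff hopf_unit_arrows)
  have "aPhi C (hopf_unit C, hopf_unit C, \<iota> \<K>) = \<one> \<K>"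
    by (simp add: aPhi_def a hopf_unit_arrows)
  with a show ?thesis
    by (simp add: hopf_bracoid_iff hopf_algebra_unit hopf_unit_arrows)
qed

lemma hopf_tensor_unit_left:
  assumes "hopf_algebra C X"
  shows "hopf_tensor C (hopf_unit C) X = X"
  using hopf_arr[OF assms]
  by (intro hopf_eqI[of _ _ C])
    (simp_all add: hopf_tensor_arrows hopf_unit_arrows interchange_def)

lemma hopf_tensor_unit_right:
  assumes "hopf_algebra C X"
  shows "hopf_tensor C X (hopf_unit C) = X"
  using hopf_arr[OF assms]
  by (intro hopf_eqI[of _ _ C])
    (simp_all add: hopf_tensor_arrows hopf_unit_arrows interchange_def)

text \<open>The form of \<open>interchange_assoc\<close> for the inverse comparison.
  \<open>\<gamma> P'' Q\<close> comes first on either side; the crossings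
  \<open>\<gamma> P' Q\<close> and \<open>\<gamma> P'' Q'\<close> that follow act on disjoint
  factors.\<close>

lemma interchange_coassoc:
  assumes [simp]: "P \<in> Obj C" "P' \<in> Obj C" "P'' \<in> Obj C" "Q \<in> Obj C" "Q' \<in> Obj C" "Q'' \<in> Obj C"
  shows "(\<chi> P P' Q Q' \<star> \<one> (P'' \<otimes> Q'')) \<odot> \<chi> (P \<otimes> P') P'' (Q \<otimes> Q') Q''
    = (\<one> (P \<otimes> Q) \<star> \<chi> P' P'' Q' Q'') \<odot> \<chi> P (P' \<otimes> P'') Q (Q' \<otimes> Q'')"
proof -
  have "(\<one> (P \<otimes> Q \<otimes> P') \<star> \<gamma> P'' Q' \<star> \<one> Q'') \<odot> (\<one> P \<star> \<gamma> P' Q \<star> \<one> (P'' \<otimes> Q' \<otimes> Q''))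
      = (\<one> P \<star> \<gamma> P' Q \<star> \<one> (Q' \<otimes> P'' \<otimes> Q'')) \<odot> (\<one> (P \<otimes> P' \<otimes> Q) \<star> \<gamma> P'' Q' \<star> \<one> Q'')"
    using exchange[of "\<one> P \<star> \<gamma> P' Q" "\<gamma> P'' Q' \<star> \<one> Q''"] by simp
  from reassoc[OF this] show ?thesis
    by (simp add: interchange_def abraid_tensor_left abraid_tensor_right whisker_left whisker_right)
qed

text \<open>Stated for arbitrary arrows out of a product of two objects, so that it covers
  multiplications and actions at once.\<close>

lemma tensor_action_assoc:
  assumes "arr C f" "src f = P \<otimes> Q" "arr C g" "src g = P' \<otimes> Q'" "arr C h" "src h = P'' \<otimes> Q''"
    and [simp]: "P \<in> Obj C" "P' \<in> Obj C" "P'' \<in> Obj C" "Q \<in> Obj C" "Q' \<in> Obj C" "Q'' \<in> Obj C"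
  shows "(((f \<star> g) \<odot> \<chi> P P' Q Q') \<star> h) \<odot> \<chi> (P \<otimes> P') P'' (Q \<otimes> Q') Q''
    = (f \<star> ((g \<star> h) \<odot> \<chi> P' P'' Q' Q'')) \<odot> \<chi> P (P' \<otimes> P'') Q (Q' \<otimes> Q'')"
proof -
  note [simp] = assms(1-6)
  have l: "((f \<star> g) \<odot> \<chi> P P' Q Q') \<star> h = (f \<star> g \<star> h) \<odot> (\<chi> P P' Q Q' \<star> \<one> (P'' \<otimes> Q''))"
    using atens_acomp[of "\<chi> P P' Q Q'" "f \<star> g" "\<one> (P'' \<otimes> Q'')" h] by simp
  have r: "f \<star> ((g \<star> h) \<odot> \<chi> P' P'' Q' Q'') = (f \<star> g \<star> h) \<odot> (\<one> (P \<otimes> Q) \<star> \<chi> P' P'' Q' Q'')"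
    using atens_acomp[of "\<one> (P \<otimes> Q)" f "\<chi> P' P'' Q' Q''" "g \<star> h"] by simp
  show ?thesis
    unfolding l r by (simp add: interchange_coassoc)
qed

lemma tensor_coaction_assoc:
  assumes "arr C f" "tgt f = P \<otimes> P'" "arr C g" "tgt g = Q \<otimes> Q'" "arr C h" "tgt h = R \<otimes> R'"
    and [simp]: "P \<in> Obj C" "P' \<in> Obj C" "Q \<in> Obj C" "Q' \<in> Obj C" "R \<in> Obj C" "R' \<in> Obj C"
  shows "\<chi> (P \<otimes> Q) (P' \<otimes> Q') R R' \<odot> ((\<chi> P P' Q Q' \<odot> (f \<star> g)) \<star> h)
    = \<chi> P P' (Q \<otimes> R) (Q' \<otimes> R') \<odot> (f \<star> (\<chi> Q Q' R R' \<odot> (g \<star> h)))"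
proof -
  note [simp] = assms(1-6)
  have l: "(\<chi> P P' Q Q' \<odot> (f \<star> g)) \<star> h = (\<chi> P P' Q Q' \<star> \<one> (R \<otimes> R')) \<odot> (f \<star> g \<star> h)"
    using atens_acomp[of "f \<star> g" "\<chi> P P' Q Q'" h "\<one> (R \<otimes> R')"] by simp
  have r: "f \<star> (\<chi> Q Q' R R' \<odot> (g \<star> h)) = (\<one> (P \<otimes> P') \<star> \<chi> Q Q' R R') \<odot> (f \<star> g \<star> h)"
    using atens_acomp[of f "\<one> (P \<otimes> P')" "g \<star> h" "\<chi> Q Q' R R'"] by simp
  have "\<chi> (P \<otimes> Q) (P' \<otimes> Q') R R' \<odot> (\<chi> P P' Q Q' \<star> \<one> (R \<otimes> R')) \<odot> (f \<star> g \<star> h)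
      = (\<chi> (P \<otimes> Q) (P' \<otimes> Q') R R' \<odot> (\<chi> P P' Q Q' \<star> \<one> (R \<otimes> R'))) \<odot> (f \<star> g \<star> h)"
    by simp
  then show ?thesis
    unfolding l r by (simp add: interchange_assoc)
qed

lemma hopf_tensor_assoc:
  assumes "hopf_algebra C X" "hopf_algebra C Y" "hopf_algebra C Z"
  shows "hopf_tensor C (hopf_tensor C X Y) Z = hopf_tensor C X (hopf_tensor C Y Z)"
  using hopf_arr[OF assms(1)] hopf_arr[OF assms(2)] hopf_arr[OF assms(3)]
  by (intro hopf_eqI[of _ _ C])
    (simp_all add: hopf_tensor_arrows tensor_action_assoc tensor_coaction_assoc)

lemma bracoid_eqI:
  assumes "fst X = fst Y" "fst (snd X) = fst (snd Y)" "aaction C X = aaction C Y"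
  shows "X = Y"
  using assms by (cases X; cases Y) (auto simp: arrow_eq_iff)

lemma bracoid_tensor_assoc:
  assumes "hopf_bracoid C X" "hopf_bracoid C Y" "hopf_bracoid C Z"
  shows "bracoid_tensor C (bracoid_tensor C X Y) Z = bracoid_tensor C X (bracoid_tensor C Y Z)"
proof -
  obtain H B \<phi> A D \<psi> P Q \<omega> where X: "X = (H, B, \<phi>)" and Y: "Y = (A, D, \<psi>)" and Z: "Z = (P, Q, \<omega>)"
    by (cases X, cases Y, cases Z) auto
  have hopf: "hopf_algebra C H" "hopf_algebra C B" "hopf_algebra C A" "hopf_algebra C D"
    "hopf_algebra C P" "hopf_algebra C Q"
    and [simp]: "arr C (aaction C (H, B, \<phi>))" "arr C (aaction C (A, D, \<psi>))" "arr C (aaction C (P, Q, \<omega>))"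
    using assms unfolding X Y Z hopf_bracoid_iff by simp_all
  note [simp] = hopf[THEN hopf_arr(1)] hopf_tensor_assoc[OF hopf(1,3,5)] hopf_tensor_assoc[OF hopf(2,4,6)]
  \<comment> \<open>The inner actions stay opaque under names, so that
    \<open>bracoid_tensor_arrow\<close> applies to the outer tensor product as it does to any
    explicit triple.\<close>
  obtain \<xi> \<zeta> where XY: "bracoid_tensor C X Y = (hopf_tensor C H A, hopf_tensor C B D, \<xi>)"
    and YZ: "bracoid_tensor C Y Z = (hopf_tensor C A P, hopf_tensor C D Q, \<zeta>)"
    by (simp add: bracoid_tensor_def X Y Z)
  have "aaction C (bracoid_tensor C (bracoid_tensor C X Y) Z)
      = (aaction C (bracoid_tensor C X Y) \<star> aaction C Z)
        \<odot> \<chi> (carrier H \<otimes> carrier A) (carrier P) (carrier B \<otimes> carrier D) (carrier Q)"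
    unfolding XY Z by (simp add: bracoid_tensor_arrow)
  moreover have "aaction C (bracoid_tensor C X (bracoid_tensor C Y Z))
      = (aaction C X \<star> aaction C (bracoid_tensor C Y Z))
        \<odot> \<chi> (carrier H) (carrier A \<otimes> carrier P) (carrier B) (carrier D \<otimes> carrier Q)"
    unfolding YZ X by (simp add: bracoid_tensor_arrow)
  ultimately have "aaction C (bracoid_tensor C (bracoid_tensor C X Y) Z)
      = aaction C (bracoid_tensor C X (bracoid_tensor C Y Z))"
    using tensor_action_assoc[of "aaction C X" _ _ "aaction C Y" _ _ "aaction C Z"]
    by (simp add: bracoid_tensor_arrow X Y Z)
  then show ?thesis
    by (rule bracoid_eqI[rotated 2]) (simp_all add: X Y Z bracoid_tensor_def)
qed

lemma bracoid_tensor_unit: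
  assumes "hopf_bracoid C X"
  shows "bracoid_tensor C (hopf_unit C, hopf_unit C, \<iota> \<K>) X = X"
    and "bracoid_tensor C X (hopf_unit C, hopf_unit C, \<iota> \<K>) = X"
proof -
  obtain H B \<phi> where X: "X = (H, B, \<phi>)"
    by (cases X) auto
  have hopf: "hopf_algebra C H" "hopf_algebra C B" and [simp]: "arr C (aaction C (H, B, \<phi>))"
    using assms unfolding X hopf_bracoid_iff by simp_all
  note [simp] = hopf[THEN hopf_arr(1)] hopf[THEN hopf_tensor_unit_left] hopf[THEN hopf_tensor_unit_right]
  have [simp]: "aaction C (hopf_unit C, hopf_unit C, \<iota> \<K>) = \<one> \<K>"
    by (simp add: arrow_eq_iff hopf_unit_arrows)
  show "bracoid_tensor C (hopf_unit C, hopf_unit C, \<iota> \<K>) X = X"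
    unfolding X
    by (rule bracoid_eqI, simp_all only: bracoid_tensor_arrow hopf hopf_arr hopf_algebra_unit)
      (simp_all add: bracoid_tensor_def hopf_unit_arrows interchange_def)
  show "bracoid_tensor C X (hopf_unit C, hopf_unit C, \<iota> \<K>) = X"
    unfolding X
    by (rule bracoid_eqI, simp_all only: bracoid_tensor_arrow hopf hopf_arr hopf_algebra_unit)
      (simp_all add: bracoid_tensor_def hopf_unit_arrows interchange_def)
qed

end

section \<open>Morphisms of Hopf bracoids\<close>

abbreviation ahom :: "('o, 'm) hopf \<Rightarrow> ('o, 'm) hopf \<Rightarrow> 'm \<Rightarrow> ('o, 'm) arrow" where
  "ahom X Y f \<equiv> Arrow (carrier X) f (carrier Y)"

lemma Arrow_simps:
  "Arrow P (\<iota>\<^bsub>C\<^esub> P) P = \<one>\<^bsub>C\<^esub> P"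
  "Arrow (P \<otimes>\<^bsub>C\<^esub> Q) (f \<boxtimes>\<^bsub>C\<^esub> g) (P' \<otimes>\<^bsub>C\<^esub> Q') = Arrow P f P' \<star>\<^bsub>C\<^esub> Arrow Q g Q'"
  "Arrow (P \<otimes>\<^bsub>C\<^esub> Q) (\<c>\<^bsub>C\<^esub> P Q) (Q \<otimes>\<^bsub>C\<^esub> P) = \<gamma>\<^bsub>C\<^esub> P Q"
  by (simp_all add: arrow_eq_iff)

text \<open>The middle object \<open>Q\<close> cannot be recovered from the raw composite; it has to
  be supplied at each use.\<close>

lemma Arrow_comp: "Arrow P (g \<cdot>\<^bsub>C\<^esub> f) R = Arrow Q g R \<odot>\<^bsub>C\<^esub> Arrow P f Q"
  by (simp add: arrow_eq_iff)

context strict_symmetric_category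
begin

section \<open>Morphisms of Hopf algebras\<close>

lemma hopf_morphism_iff:
  assumes "hopf_algebra C X" "hopf_algebra C Y"
  shows "hopf_morphism C X Y f \<longleftrightarrow> arr C (ahom X Y f) \<and>
    ahom X Y f \<odot> aunit C X = aunit C Y \<and>
    ahom X Y f \<odot> amult C X = amult C Y \<odot> (ahom X Y f \<star> ahom X Y f) \<and>
    acounit C Y \<odot> ahom X Y f = acounit C X \<and>
    acomult C Y \<odot> ahom X Y f = (ahom X Y f \<star> ahom X Y f) \<odot> acomult C X"
  using hopf_arr(1)[OF assms(1)] hopf_arr(1)[OF assms(2)]
  by (auto simp: hopf_morphism_def algebra_morphism_def coalgebra_morphism_def arrow_eq_iff arr_def)

lemma bracoid_morphism_iff:
  "bracoid_morphism C (H, B, \<phi>) (H', B', \<phi>') (f, g) \<longleftrightarrow>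
    hopf_morphism C H H' f \<and> hopf_morphism C B B' g \<and>
    ahom B B' g \<odot> aaction C (H, B, \<phi>) = aaction C (H', B', \<phi>') \<odot> (ahom H H' f \<star> ahom B B' g)"
  by (auto simp: bracoid_morphism_def arrow_eq_iff)

lemma hopf_morphism_id:
  assumes "hopf_algebra C X"
  shows "hopf_morphism C X X (\<iota> (carrier X))"
  using hopf_arr[OF assms] by (simp add: hopf_morphism_iff assms Arrow_simps)

lemma hopf_morphism_comp:
  assumes "hopf_algebra C X" "hopf_algebra C Y" "hopf_algebra C Z"
    and "hopf_morphism C X Y f" "hopf_morphism C Y Z g"
  shows "hopf_morphism C X Z (g \<cdot> f)"
proof -
  note [simp] = hopf_arr[OF assms(1)] hopf_arr[OF assms(2)] hopf_arr[OF assms(3)]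
  let ?f = "ahom X Y f" and ?g = "ahom Y Z g"
  have f: "arr C ?f" "?f \<odot> aunit C X = aunit C Y" "?f \<odot> amult C X = amult C Y \<odot> (?f \<star> ?f)"
    "acounit C Y \<odot> ?f = acounit C X" "acomult C Y \<odot> ?f = (?f \<star> ?f) \<odot> acomult C X"
    using assms by (simp_all add: hopf_morphism_iff)
  have g: "arr C ?g" "?g \<odot> aunit C Y = aunit C Z" "?g \<odot> amult C Y = amult C Z \<odot> (?g \<star> ?g)"
    "acounit C Z \<odot> ?g = acounit C Y" "acomult C Z \<odot> ?g = (?g \<star> ?g) \<odot> acomult C Y"
    using assms by (simp_all add: hopf_morphism_iff)
  have gg: "(?g \<odot> ?f) \<star> (?g \<odot> ?f) = (?g \<star> ?g) \<odot> (?f \<star> ?f)"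
    using f(1) g(1) by (simp add: atens_acomp)
  show ?thesis
    using f g
    by (simp add: hopf_morphism_iff assms Arrow_comp[of "carrier X" C g f "carrier Z" "carrier Y"] gg
        reassoc[OF g(3)] reassoc[OF g(4)] reassoc[OF g(5)])
qed

text \<open>Squares over two-argument operations tensor to a square over the interchanged
  operations, by naturality of the interchange. With \<open>h = k = f\<close> this is
  multiplicativity; with different \<open>h\<close> and \<open>k\<close> it is compatibility with
  actions.\<close>

lemma tensor_square:
  assumes "f \<odot> m = m' \<odot> (h \<star> k)" "g \<odot> n = n' \<odot> (i \<star> j)"
    and [simp]: "arr C f" "arr C g" "arr C h" "arr C k" "arr C i" "arr C j"
      "arr C m" "arr C n" "arr C m'" "arr C n'"
      "src f = tgt m" "src g = tgt n" "src m = src h \<otimes> src k" "src n = src i \<otimes> src j"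
      "src m' = tgt h \<otimes> tgt k" "src n' = tgt i \<otimes> tgt j"
  shows "(f \<star> g) \<odot> (m \<star> n) \<odot> \<chi> (src h) (src i) (src k) (src j)
    = (m' \<star> n') \<odot> \<chi> (tgt h) (tgt i) (tgt k) (tgt j) \<odot> (h \<star> i \<star> k \<star> j)"
proof -
  have "(f \<star> g) \<odot> (m \<star> n) \<odot> \<chi> (src h) (src i) (src k) (src j)
      = ((f \<odot> m) \<star> (g \<odot> n)) \<odot> \<chi> (src h) (src i) (src k) (src j)"
    by (simp flip: atens_acomp)
  also have "\<dots> = (m' \<star> n') \<odot> (h \<star> k \<star> i \<star> j) \<odot> \<chi> (src h) (src i) (src k) (src j)"
    using atens_acomp[of "h \<star> k" m' "i \<star> j" n'] by (simp add: assms(1,2) flip: acomp_assoc)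
  also have "\<dots> = (m' \<star> n') \<odot> \<chi> (tgt h) (tgt i) (tgt k) (tgt j) \<odot> (h \<star> i \<star> k \<star> j)"
    by (simp add: interchange_natural)
  finally show ?thesis .
qed

lemma tensor_cosquare:
  assumes "d' \<odot> f = (f \<star> f) \<odot> d" "e' \<odot> g = (g \<star> g) \<odot> e"
    and [simp]: "arr C f" "arr C g" "arr C d" "arr C e" "arr C d'" "arr C e'"
      "src f = src d" "src g = src e" "tgt f = src d'" "tgt g = src e'"
      "tgt d = src d \<otimes> src d" "tgt e = src e \<otimes> src e"
      "tgt d' = src d' \<otimes> src d'" "tgt e' = src e' \<otimes> src e'"
  shows "\<chi> (src d') (src d') (src e') (src e') \<odot> (d' \<star> e') \<odot> (f \<star> g)
    = (f \<star> g \<star> f \<star> g) \<odot> \<chi> (src d) (src d) (src e) (src e) \<odot> (d \<star> e)"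
proof -
  have "\<chi> (src d') (src d') (src e') (src e') \<odot> (d' \<star> e') \<odot> (f \<star> g)
      = \<chi> (src d') (src d') (src e') (src e') \<odot> ((f \<star> f) \<odot> d) \<star> ((g \<star> g) \<odot> e)"
    by (simp add: atens_acomp assms(1,2))
  also have "\<dots> = \<chi> (src d') (src d') (src e') (src e') \<odot> (f \<star> f \<star> g \<star> g) \<odot> (d \<star> e)"
    using atens_acomp[of d "f \<star> f" e "g \<star> g"] by simp
  also have "\<dots> = (f \<star> g \<star> f \<star> g) \<odot> \<chi> (src d) (src d) (src e) (src e) \<odot> (d \<star> e)"
    by (simp add: interchange_natural reassoc[OF interchange_natural])
  finally show ?thesis .
qed

lemma hopf_morphism_tensor:
  assumes "hopf_algebra C X" "hopf_algebra C X'" "hopf_algebra C Y" "hopf_algebra C Y'"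
    and "hopf_morphism C X X' f" "hopf_morphism C Y Y' g"
  shows "hopf_morphism C (hopf_tensor C X Y) (hopf_tensor C X' Y') (f \<boxtimes> g)"
proof -
  note [simp] = hopf_arr[OF assms(1)] hopf_arr[OF assms(2)] hopf_arr[OF assms(3)] hopf_arr[OF assms(4)]
  let ?f = "ahom X X' f" and ?g = "ahom Y Y' g"
  have f: "arr C ?f" "?f \<odot> aunit C X = aunit C X'" "?f \<odot> amult C X = amult C X' \<odot> (?f \<star> ?f)"
    "acounit C X' \<odot> ?f = acounit C X" "acomult C X' \<odot> ?f = (?f \<star> ?f) \<odot> acomult C X"
    using assms by (simp_all add: hopf_morphism_iff)
  have g: "arr C ?g" "?g \<odot> aunit C Y = aunit C Y'" "?g \<odot> amult C Y = amult C Y' \<odot> (?g \<star> ?g)"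
    "acounit C Y' \<odot> ?g = acounit C Y" "acomult C Y' \<odot> ?g = (?g \<star> ?g) \<odot> acomult C Y"
    using assms by (simp_all add: hopf_morphism_iff)
  have "(?f \<star> ?g) \<odot> (aunit C X \<star> aunit C Y) = aunit C X' \<star> aunit C Y'"
    "(acounit C X' \<star> acounit C Y') \<odot> (?f \<star> ?g) = acounit C X \<star> acounit C Y"
    using f g by (simp_all add: atens_acomp)
  then show ?thesis
    using f(1) g(1) tensor_square[OF f(3) g(3)] tensor_cosquare[OF f(5) g(5)]
    by (simp add: hopf_morphism_iff hopf_algebra_tensor assms Arrow_simps hopf_tensor_arrows)
qed

text \<open>Naturality slides the braiding past \<open>m \<star> n\<close>, and the second form of
  \<open>interchange_braid\<close> moves it past the interchange. Multiplications and actions are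
  both instances.\<close>

lemma braid_square:
  assumes [simp]: "arr C m" "arr C n" "src m = P \<otimes> Q" "src n = P' \<otimes> Q'"
    "P \<in> Obj C" "Q \<in> Obj C" "P' \<in> Obj C" "Q' \<in> Obj C"
  shows "\<gamma> (tgt m) (tgt n) \<odot> (m \<star> n) \<odot> \<chi> P P' Q Q'
    = (n \<star> m) \<odot> \<chi> P' P Q' Q \<odot> (\<gamma> P P' \<star> \<gamma> Q Q')"
  by (simp add: reassoc[OF abraid_natural] interchange_braid)

lemma braid_cosquare:
  assumes [simp]: "arr C d" "arr C e" "tgt d = P \<otimes> P" "tgt e = Q \<otimes> Q" "P \<in> Obj C" "Q \<in> Obj C"
  shows "\<chi> Q Q P P \<odot> (e \<star> d) \<odot> \<gamma> (src d) (src e)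
    = (\<gamma> P Q \<star> \<gamma> P Q) \<odot> \<chi> P P Q Q \<odot> (d \<star> e)"
  using abraid_natural[of d e "P \<otimes> P" "Q \<otimes> Q"] interchange_braid(1)[of P P Q Q]
  by (simp add: reassoc[OF interchange_braid(1)] flip: abraid_natural)

lemma hopf_morphism_braiding:
  assumes "hopf_algebra C X" "hopf_algebra C Y"
  shows "hopf_morphism C (hopf_tensor C X Y) (hopf_tensor C Y X) (\<c> (carrier X) (carrier Y))"
proof -
  note [simp] = hopf_arr[OF assms(1)] hopf_arr[OF assms(2)]
  let ?X = "carrier X" and ?Y = "carrier Y"
  have unit: "\<gamma> ?X ?Y \<odot> (aunit C X \<star> aunit C Y) = aunit C Y \<star> aunit C X"
    using abraid_natural[of "aunit C X" "aunit C Y"] by simp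
  have counit: "(acounit C Y \<star> acounit C X) \<odot> \<gamma> ?X ?Y = acounit C X \<star> acounit C Y"
  proof -
    \<comment> \<open>The counits end in \<open>\<K>\<close>, so naturality leaves only
      \<open>\<gamma> \<K> \<K>\<close>, an identity.\<close>
    have "(acounit C Y \<star> acounit C X) \<odot> \<gamma> ?X ?Y = \<gamma> \<K> \<K> \<odot> (acounit C X \<star> acounit C Y)"
      by (subst abraid_natural) (simp_all only: hopf_sel hopf_arr assms)
    then show ?thesis
      by simp
  qed
  have mult: "\<gamma> ?X ?Y \<odot> (amult C X \<star> amult C Y) \<odot> \<chi> ?X ?Y ?X ?Y
      = (amult C Y \<star> amult C X) \<odot> \<chi> ?Y ?X ?Y ?X \<odot> (\<gamma> ?X ?Y \<star> \<gamma> ?X ?Y)"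
    using braid_square[of "amult C X" "amult C Y" ?X ?X ?Y ?Y] by simp
  have comult: "\<chi> ?Y ?Y ?X ?X \<odot> (acomult C Y \<star> acomult C X) \<odot> \<gamma> ?X ?Y
      = (\<gamma> ?X ?Y \<star> \<gamma> ?X ?Y) \<odot> \<chi> ?X ?X ?Y ?Y \<odot> (acomult C X \<star> acomult C Y)"
    using braid_cosquare[of "acomult C X" "acomult C Y" ?X ?Y] by simp
  show ?thesis
    using unit counit mult comult
    by (simp add: hopf_morphism_iff hopf_algebra_tensor assms Arrow_simps hopf_tensor_arrows)
qed

section \<open>Morphisms of bracoids: identities, composites, tensor products and the
  braiding\<close>

lemma hopf_bracoid_arr:
  assumes "hopf_bracoid C (H, B, \<phi>)"
  shows "hopf_algebra C H" "hopf_algebra C B" "arr C (aaction C (H, B, \<phi>))"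
    "carrier H \<in> Obj C" "carrier B \<in> Obj C"
  using assms hopf_arr(1) unfolding hopf_bracoid_iff by auto

lemma bracoid_morphism_arr:
  assumes "hopf_bracoid C (H, B, \<phi>)" "hopf_bracoid C (H', B', \<phi>')"
    and "bracoid_morphism C (H, B, \<phi>) (H', B', \<phi>') (f, g)"
  shows "arr C (ahom H H' f)" "arr C (ahom B B' g)"
  using assms by (auto simp: hopf_bracoid_iff bracoid_morphism_iff hopf_morphism_iff)

lemma bracoid_morphism_id:
  assumes "hopf_bracoid C (H, B, \<phi>)"
  shows "bracoid_morphism C (H, B, \<phi>) (H, B, \<phi>) (\<iota> (carrier H), \<iota> (carrier B))"
  using hopf_bracoid_arr[OF assms] by (simp add: bracoid_morphism_iff hopf_morphism_id Arrow_simps)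

lemma bracoid_morphism_comp:
  assumes "hopf_bracoid C (H, B, \<phi>)" "hopf_bracoid C (H', B', \<phi>')" "hopf_bracoid C (H'', B'', \<phi>'')"
    and "bracoid_morphism C (H, B, \<phi>) (H', B', \<phi>') (f, g)"
    and "bracoid_morphism C (H', B', \<phi>') (H'', B'', \<phi>'') (f', g')"
  shows "bracoid_morphism C (H, B, \<phi>) (H'', B'', \<phi>'') (f' \<cdot> f, g' \<cdot> g)"
proof -
  note [simp] = hopf_bracoid_arr[OF assms(1)] hopf_bracoid_arr[OF assms(2)] hopf_bracoid_arr[OF assms(3)]
    bracoid_morphism_arr[OF assms(1,2,4)] bracoid_morphism_arr[OF assms(2,3,5)]
  have "hopf_morphism C H H'' (f' \<cdot> f)" "hopf_morphism C B B'' (g' \<cdot> g)"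
    using assms(4,5) hopf_morphism_comp[of H H' H''] hopf_morphism_comp[of B B' B'']
    by (auto simp: bracoid_morphism_iff)
  moreover have "ahom B B' g \<odot> aaction C (H, B, \<phi>) = aaction C (H', B', \<phi>') \<odot> (ahom H H' f \<star> ahom B B' g)"
    and eq: "ahom B' B'' g' \<odot> aaction C (H', B', \<phi>')
      = aaction C (H'', B'', \<phi>'') \<odot> (ahom H' H'' f' \<star> ahom B' B'' g')"
    using assms(4,5) by (simp_all add: bracoid_morphism_iff)
  ultimately show ?thesis
    by (simp add: bracoid_morphism_iff Arrow_comp[of "carrier H" C f' f "carrier H''" "carrier H'"]
        Arrow_comp[of "carrier B" C g' g "carrier B''" "carrier B'"] reassoc[OF eq] atens_acomp)
qed

lemma bracoid_morphism_tensor: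
  assumes "hopf_bracoid C (H, B, \<phi>)" "hopf_bracoid C (H', B', \<phi>')"
    and "hopf_bracoid C (A, D, \<psi>)" "hopf_bracoid C (A', D', \<psi>')"
    and "bracoid_morphism C (H, B, \<phi>) (H', B', \<phi>') (f, g)"
    and "bracoid_morphism C (A, D, \<psi>) (A', D', \<psi>') (h, k)"
  shows "bracoid_morphism C (bracoid_tensor C (H, B, \<phi>) (A, D, \<psi>))
    (bracoid_tensor C (H', B', \<phi>') (A', D', \<psi>')) (f \<boxtimes> h, g \<boxtimes> k)"
proof -
  note [simp] = hopf_bracoid_arr[OF assms(1)] hopf_bracoid_arr[OF assms(2)] hopf_bracoid_arr[OF assms(3)]
    hopf_bracoid_arr[OF assms(4)] bracoid_morphism_arr[OF assms(1,2,5)] bracoid_morphism_arr[OF assms(3,4,6)]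
  obtain \<xi> \<zeta> where t: "bracoid_tensor C (H, B, \<phi>) (A, D, \<psi>) = (hopf_tensor C H A, hopf_tensor C B D, \<xi>)"
    "bracoid_tensor C (H', B', \<phi>') (A', D', \<psi>') = (hopf_tensor C H' A', hopf_tensor C B' D', \<zeta>)"
    by (simp add: bracoid_tensor_def)
  have a: "aaction C (hopf_tensor C H A, hopf_tensor C B D, \<xi>)
      = (aaction C (H, B, \<phi>) \<star> aaction C (A, D, \<psi>)) \<odot> \<chi> (carrier H) (carrier A) (carrier B) (carrier D)"
    "aaction C (hopf_tensor C H' A', hopf_tensor C B' D', \<zeta>)
      = (aaction C (H', B', \<phi>') \<star> aaction C (A', D', \<psi>')) \<odot> \<chi> (carrier H') (carrier A') (carrier B') (carrier D')"
    unfolding t[symmetric] by (simp_all add: bracoid_tensor_arrow)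
  have "ahom B B' g \<odot> aaction C (H, B, \<phi>) = aaction C (H', B', \<phi>') \<odot> (ahom H H' f \<star> ahom B B' g)"
    "ahom D D' k \<odot> aaction C (A, D, \<psi>) = aaction C (A', D', \<psi>') \<odot> (ahom A A' h \<star> ahom D D' k)"
    using assms(5,6) by (simp_all add: bracoid_morphism_iff)
  from tensor_square[OF this] show ?thesis
    using assms(5,6) unfolding t
    by (simp add: bracoid_morphism_iff a hopf_morphism_tensor Arrow_simps)
qed

lemma bracoid_morphism_braiding:
  assumes "hopf_bracoid C (H, B, \<phi>)" "hopf_bracoid C (A, D, \<psi>)"
  shows "bracoid_morphism C (bracoid_tensor C (H, B, \<phi>) (A, D, \<psi>))
    (bracoid_tensor C (A, D, \<psi>) (H, B, \<phi>)) (\<c> (carrier H) (carrier A), \<c> (carrier B) (carrier D))"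
proof -
  note [simp] = hopf_bracoid_arr[OF assms(1)] hopf_bracoid_arr[OF assms(2)]
  obtain \<xi> \<zeta> where t: "bracoid_tensor C (H, B, \<phi>) (A, D, \<psi>) = (hopf_tensor C H A, hopf_tensor C B D, \<xi>)"
    "bracoid_tensor C (A, D, \<psi>) (H, B, \<phi>) = (hopf_tensor C A H, hopf_tensor C D B, \<zeta>)"
    by (simp add: bracoid_tensor_def)
  have a: "aaction C (hopf_tensor C H A, hopf_tensor C B D, \<xi>)
      = (aaction C (H, B, \<phi>) \<star> aaction C (A, D, \<psi>)) \<odot> \<chi> (carrier H) (carrier A) (carrier B) (carrier D)"
    "aaction C (hopf_tensor C A H, hopf_tensor C D B, \<zeta>)
      = (aaction C (A, D, \<psi>) \<star> aaction C (H, B, \<phi>)) \<odot> \<chi> (carrier A) (carrier H) (carrier D) (carrier B)"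
    unfolding t[symmetric] by (simp_all add: bracoid_tensor_arrow)
  show ?thesis
    using braid_square[of "aaction C (H, B, \<phi>)" "aaction C (A, D, \<psi>)"
      "carrier H" "carrier B" "carrier A" "carrier D"] unfolding t
    by (simp add: bracoid_morphism_iff a hopf_morphism_braiding Arrow_simps)
qed

end

section \<open>The category of Hopf bracoids\<close>

abbreviation acar :: "('o, 'm) bracoid \<Rightarrow> 'o" where
  "acar X \<equiv> carrier (fst X)"

abbreviation bcar :: "('o, 'm) bracoid \<Rightarrow> 'o" where
  "bcar X \<equiv> carrier (fst (snd X))"

lemma bracoid_tensor_sel [simp]:
  "fst (bracoid_tensor C X Y) = hopf_tensor C (fst X) (fst Y)"
  "fst (snd (bracoid_tensor C X Y)) = hopf_tensor C (fst (snd X)) (fst (snd Y))"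
  by (simp_all add: bracoid_tensor_def split_beta)

text \<open>Projections replace the pattern matching of the definition, so that these equations
  rewrite at variables as well.\<close>

lemma HBrcd_simps:
  "X \<in> Obj (HBrcd C) \<longleftrightarrow> hopf_bracoid C X"
  "h \<in> Hom (HBrcd C) X Y \<longleftrightarrow> bracoid_morphism C X Y h"
  "\<iota>\<^bsub>HBrcd C\<^esub> X = (\<iota>\<^bsub>C\<^esub> (acar X), \<iota>\<^bsub>C\<^esub> (bcar X))"
  "k \<cdot>\<^bsub>HBrcd C\<^esub> h = (fst k \<cdot>\<^bsub>C\<^esub> fst h, snd k \<cdot>\<^bsub>C\<^esub> snd h)"
  "X \<otimes>\<^bsub>HBrcd C\<^esub> Y = bracoid_tensor C X Y"
  "h \<boxtimes>\<^bsub>HBrcd C\<^esub> k = (fst h \<boxtimes>\<^bsub>C\<^esub> fst k, snd h \<boxtimes>\<^bsub>C\<^esub> snd k)"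
  "\<K>\<^bsub>HBrcd C\<^esub> = (hopf_unit C, hopf_unit C, \<iota>\<^bsub>C\<^esub> \<K>\<^bsub>C\<^esub>)"
  "\<alpha>\<^bsub>HBrcd C\<^esub> X Y Z = (\<alpha>\<^bsub>C\<^esub> (acar X) (acar Y) (acar Z), \<alpha>\<^bsub>C\<^esub> (bcar X) (bcar Y) (bcar Z))"
  "\<ll>\<^bsub>HBrcd C\<^esub> X = (\<ll>\<^bsub>C\<^esub> (acar X), \<ll>\<^bsub>C\<^esub> (bcar X))"
  "\<rr>\<^bsub>HBrcd C\<^esub> X = (\<rr>\<^bsub>C\<^esub> (acar X), \<rr>\<^bsub>C\<^esub> (bcar X))"
  "\<c>\<^bsub>HBrcd C\<^esub> X Y = (\<c>\<^bsub>C\<^esub> (acar X) (acar Y), \<c>\<^bsub>C\<^esub> (bcar X) (bcar Y))"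
  by (simp_all add: HBrcd_def split_beta)

context strict_symmetric_category
begin

lemma bracoid_Obj:
  "hopf_bracoid C X \<Longrightarrow> acar X \<in> Obj C" "hopf_bracoid C X \<Longrightarrow> bcar X \<in> Obj C"
  by (cases X, simp add: hopf_bracoid_arr)+

lemma bracoid_morphism_Hom:
  "bracoid_morphism C X Y h \<Longrightarrow> fst h \<in> Hom C (acar X) (acar Y)"
  "bracoid_morphism C X Y h \<Longrightarrow> snd h \<in> Hom C (bcar X) (bcar Y)"
  by (cases X; cases Y; cases h;
      simp add: bracoid_morphism_def hopf_morphism_def algebra_morphism_def)+

text \<open>Needed for the left hexagon, which is stated for given inverses of the associators: they
  are projected to inverses in \<open>C\<close>, where the hexagon is known.\<close>

lemma inverse_arrows_HBrcdD:
  "inverse_arrows (HBrcd C) X Y h k \<Longrightarrow> inverse_arrows C (acar X) (acar Y) (fst h) (fst k)"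
  "inverse_arrows (HBrcd C) X Y h k \<Longrightarrow> inverse_arrows C (bcar X) (bcar Y) (snd h) (snd k)"
  by (auto simp: inverse_arrows_def HBrcd_simps dest: bracoid_morphism_Hom)

lemma category_HBrcd: "category (HBrcd C)"
proof (unfold_locales, unfold HBrcd_simps, goal_cases)
  case (1 A)
  then show ?case by (cases A) (simp add: bracoid_morphism_id)
next
  case (2 P Q R f g)
  then show ?case
    by (cases P, cases Q, cases R, cases f, cases g) (simp add: bracoid_morphism_comp)
next
  case (3 P Q f)
  \<comment> \<open>Here and below, \<open>o\<close> and \<open>m\<close> list the data of the first
    components followed by those of the second; a law of \<open>C\<close> is applied once to each
    half.\<close>
  note o = 3(1,2)[THEN bracoid_Obj(1)] 3(1,2)[THEN bracoid_Obj(2)]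
  note m = 3(3)[THEN bracoid_morphism_Hom(1)] 3(3)[THEN bracoid_morphism_Hom(2)]
  show ?case
    using Id_left[OF o(1,2) m(1)] Id_left[OF o(3,4) m(2)] by simp
next
  case (4 P Q f)
  note o = 4(1,2)[THEN bracoid_Obj(1)] 4(1,2)[THEN bracoid_Obj(2)]
  note m = 4(3)[THEN bracoid_morphism_Hom(1)] 4(3)[THEN bracoid_morphism_Hom(2)]
  show ?case
    using Id_right[OF o(1,2) m(1)] Id_right[OF o(3,4) m(2)] by simp
next
  case (5 P Q R S f g h)
  note o = 5(1-4)[THEN bracoid_Obj(1)] 5(1-4)[THEN bracoid_Obj(2)]
  note m = 5(5-7)[THEN bracoid_morphism_Hom(1)] 5(5-7)[THEN bracoid_morphism_Hom(2)]
  show ?case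
    using Comp_assoc[OF o(1-4) m(1-3)] Comp_assoc[OF o(5-8) m(4-6)] by simp
qed

text \<open>Handles associators and unitors: their source and target are the same bracoid, and they
  are its identity.\<close>

lemma isomorphism_HBrcd_Id:
  assumes "hopf_bracoid C X" "h = \<iota>\<^bsub>HBrcd C\<^esub> X"
  shows "isomorphism (HBrcd C) X X h"
proof -
  interpret H: category "HBrcd C"
    by (rule category_HBrcd)
  have X: "X \<in> Obj (HBrcd C)"
    using assms(1) by (simp add: HBrcd_simps)
  show ?thesis
    unfolding isomorphism_def inverse_arrows_def assms(2)
    using H.Id_Hom[OF X] H.Id_left[OF X X H.Id_Hom[OF X]] by blast
qed

text \<open>Equations between morphisms are inherited componentwise from \<open>C\<close>. The
  content lies in the closure under unit and tensor product and in the coherence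
  isomorphisms.\<close>

lemma monoidal_category_HBrcd: "monoidal_category (HBrcd C)"
proof (intro monoidal_category.intro category_HBrcd monoidal_category_axioms.intro,
    unfold HBrcd_simps, goal_cases)
  case 1
  show ?case by (rule hopf_bracoid_unit)
next
  case (2 P Q)
  then show ?case by (rule hopf_bracoid_tensor)
next
  case (3 P P' Q Q' f g)
  then show ?case
    by (cases P, cases P', cases Q, cases Q', cases f, cases g) (simp add: bracoid_morphism_tensor)
next
  case (4 P Q)
  then show ?case by (simp add: tensor_Id bracoid_Obj)
next
  case (5 P P' P'' Q Q' Q'' f f' g g')
  note o = 5(1-6)[THEN bracoid_Obj(1)] 5(1-6)[THEN bracoid_Obj(2)]
  note m = 5(7-10)[THEN bracoid_morphism_Hom(1)] 5(7-10)[THEN bracoid_morphism_Hom(2)]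
  show ?case
    using tensor_Comp[OF o(1-6) m(1-4)] tensor_Comp[OF o(7-12) m(5-8)] by simp
next
  case (6 P Q R)
  then show ?case
    by (simp add: bracoid_tensor_assoc isomorphism_HBrcd_Id hopf_bracoid_tensor HBrcd_simps
        associator_Id bracoid_Obj)
next
  case (7 P P' Q Q' R R' f g h)
  note o = 7(1-6)[THEN bracoid_Obj(1)] 7(1-6)[THEN bracoid_Obj(2)]
  note m = 7(7-9)[THEN bracoid_morphism_Hom(1)] 7(7-9)[THEN bracoid_morphism_Hom(2)]
  show ?case
    using associator_natural[OF o(1-6) m(1-3)] associator_natural[OF o(7-12) m(4-6)] by simp
next
  case (8 P)
  then show ?case
    by (simp add: bracoid_tensor_unit isomorphism_HBrcd_Id HBrcd_simps left_unitor_Id bracoid_Obj)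
next
  case (9 P Q f)
  note o = 9(1,2)[THEN bracoid_Obj(1)] 9(1,2)[THEN bracoid_Obj(2)]
  note m = 9(3)[THEN bracoid_morphism_Hom(1)] 9(3)[THEN bracoid_morphism_Hom(2)]
  show ?case
    using left_unitor_natural[OF o(1,2) m(1)] left_unitor_natural[OF o(3,4) m(2)]
    by (simp add: hopf_unit_arrows)
next
  case (10 P)
  then show ?case
    by (simp add: bracoid_tensor_unit isomorphism_HBrcd_Id HBrcd_simps right_unitor_Id bracoid_Obj)
next
  case (11 P Q f)
  note o = 11(1,2)[THEN bracoid_Obj(1)] 11(1,2)[THEN bracoid_Obj(2)]
  note m = 11(3)[THEN bracoid_morphism_Hom(1)] 11(3)[THEN bracoid_morphism_Hom(2)]
  show ?case
    using right_unitor_natural[OF o(1,2) m(1)] right_unitor_natural[OF o(3,4) m(2)]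
    by (simp add: hopf_unit_arrows)
next
  case (12 P Q R S)
  note o = 12[THEN bracoid_Obj(1)] 12[THEN bracoid_Obj(2)]
  show ?case
    using pentagon[OF o(1-4)] pentagon[OF o(5-8)] by simp
next
  case (13 P Q)
  note o = 13[THEN bracoid_Obj(1)] 13[THEN bracoid_Obj(2)]
  show ?case
    using triangle[OF o(1,2)] triangle[OF o(3,4)] by (simp add: hopf_unit_arrows)
qed

text \<open>An inverse in \<open>HBrcd\<close> must itself be a bracoid morphism. By symmetry it is
  the braiding of the swapped pair, so one fact covers both directions.\<close>

lemma isomorphism_HBrcd_braiding:
  assumes "hopf_bracoid C X" "hopf_bracoid C Y"
  shows "isomorphism (HBrcd C) (bracoid_tensor C X Y) (bracoid_tensor C Y X) (\<c>\<^bsub>HBrcd C\<^esub> X Y)"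
proof -
  have "bracoid_morphism C (bracoid_tensor C V W) (bracoid_tensor C W V) (\<c>\<^bsub>HBrcd C\<^esub> V W)"
    if "hopf_bracoid C V" "hopf_bracoid C W" for V W
    using that by (cases V; cases W) (simp add: HBrcd_simps bracoid_morphism_braiding)
  then have "inverse_arrows (HBrcd C) (bracoid_tensor C X Y) (bracoid_tensor C Y X)
      (\<c>\<^bsub>HBrcd C\<^esub> X Y) (\<c>\<^bsub>HBrcd C\<^esub> Y X)"
    using assms by (simp add: inverse_arrows_def HBrcd_simps symmetry bracoid_Obj)
  then show ?thesis
    unfolding isomorphism_def ..
qed

lemma symmetric_monoidal_category_HBrcd: "symmetric_monoidal_category (HBrcd C)"
proof (intro symmetric_monoidal_category.intro braided_monoidal_category.intro
    monoidal_category_HBrcd braided_monoidal_category_axioms.intro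
    symmetric_monoidal_category_axioms.intro, goal_cases)
  case (1 P Q)
  then show ?case
    by (simp add: HBrcd_simps(1,5) isomorphism_HBrcd_braiding)
next
  case (2 P P' Q Q' f g)
  note * = 2[unfolded HBrcd_simps]
  note o = *(1-4)[THEN bracoid_Obj(1)] *(1-4)[THEN bracoid_Obj(2)]
  note m = *(5,6)[THEN bracoid_morphism_Hom(1)] *(5,6)[THEN bracoid_morphism_Hom(2)]
  show ?case
    using braiding_natural[OF o(1-4) m(1,2)] braiding_natural[OF o(5-8) m(3,4)]
    by (simp add: HBrcd_simps)
next
  case (3 P Q R)
  note o = 3[unfolded HBrcd_simps, THEN bracoid_Obj(1)] 3[unfolded HBrcd_simps, THEN bracoid_Obj(2)]
  show ?case
    using hexagon_right[OF o(1-3)] hexagon_right[OF o(4-6)] by (simp add: HBrcd_simps)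
next
  case (4 P Q R a a' a'')
  note o = 4(1-3)[unfolded HBrcd_simps, THEN bracoid_Obj(1)] 4(1-3)[unfolded HBrcd_simps, THEN bracoid_Obj(2)]
  note i = 4(4-6)[THEN inverse_arrows_HBrcdD(1)] 4(4-6)[THEN inverse_arrows_HBrcdD(2)]
  have "fst a'' \<cdot> \<c> (acar P \<otimes> acar Q) (acar R) \<cdot> fst a
      = (\<c> (acar P) (acar R) \<boxtimes> \<iota> (acar Q)) \<cdot> fst a' \<cdot> (\<iota> (acar P) \<boxtimes> \<c> (acar Q) (acar R))"
    using hexagon_left[OF o(1-3)] i(1-3) by (simp add: HBrcd_simps o)
  moreover have "snd a'' \<cdot> \<c> (bcar P \<otimes> bcar Q) (bcar R) \<cdot> snd a
      = (\<c> (bcar P) (bcar R) \<boxtimes> \<iota> (bcar Q)) \<cdot> snd a' \<cdot> (\<iota> (bcar P) \<boxtimes> \<c> (bcar Q) (bcar R))"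
    using hexagon_left[OF o(4-6)] i(4-6) by (simp add: HBrcd_simps o)
  ultimately show ?case
    by (simp add: HBrcd_simps)
next
  case (5 P Q)
  then show ?case
    by (simp add: HBrcd_simps symmetry bracoid_Obj)
qed

end

theorem theorem2p25:
  fixes C :: "('o, 'm, 'x) braided_cat_scheme"
  assumes "strict_monoidal_category C"
    and "symmetric_monoidal_category C"
  shows "symmetric_monoidal_category (HBrcd C)
    \<and> unit_obj (HBrcd C) = (hopf_unit C, hopf_unit C, \<iota>\<^bsub>C\<^esub> \<K>\<^bsub>C\<^esub>)
    \<and> (\<forall>H B \<phi> A D \<psi>. hopf_bracoid C (H, B, \<phi>) \<and> hopf_bracoid C (A, D, \<psi>) \<longrightarrow>
         (H, B, \<phi>) \<otimes>\<^bsub>HBrcd C\<^esub> (A, D, \<psi>)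
           = (hopf_tensor C H A, hopf_tensor C B D,
              (\<phi> \<boxtimes>\<^bsub>C\<^esub> \<psi>) \<cdot>\<^bsub>C\<^esub>
                (\<iota>\<^bsub>C\<^esub> (carrier H) \<boxtimes>\<^bsub>C\<^esub> \<c>\<^bsub>C\<^esub> (carrier A) (carrier B) \<boxtimes>\<^bsub>C\<^esub> \<iota>\<^bsub>C\<^esub> (carrier D)))
       \<and> \<c>\<^bsub>HBrcd C\<^esub> (H, B, \<phi>) (A, D, \<psi>)
           = (\<c>\<^bsub>C\<^esub> (carrier H) (carrier A), \<c>\<^bsub>C\<^esub> (carrier B) (carrier D))
       \<and> isomorphism (HBrcd C) ((H, B, \<phi>) \<otimes>\<^bsub>HBrcd C\<^esub> (A, D, \<psi>))
           ((A, D, \<psi>) \<otimes>\<^bsub>HBrcd C\<^esub> (H, B, \<phi>))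
           (\<c>\<^bsub>HBrcd C\<^esub> (H, B, \<phi>) (A, D, \<psi>)))
    \<and> (\<forall>f g f' g'. (f, g) \<boxtimes>\<^bsub>HBrcd C\<^esub> (f', g') = (f \<boxtimes>\<^bsub>C\<^esub> f', g \<boxtimes>\<^bsub>C\<^esub> g'))"
proof -
  interpret strict_symmetric_category C
    using assms by (rule strict_symmetric_category.intro)
  have "isomorphism (HBrcd C) (bracoid_tensor C (H, B, \<phi>) (A, D, \<psi>)) (bracoid_tensor C (A, D, \<psi>) (H, B, \<phi>))
      (\<c>\<^bsub>C\<^esub> (carrier H) (carrier A), \<c>\<^bsub>C\<^esub> (carrier B) (carrier D))"
    if "hopf_bracoid C (H, B, \<phi>)" "hopf_bracoid C (A, D, \<psi>)" for H B \<phi> A D \<psi>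
    using isomorphism_HBrcd_braiding[OF that] by (simp add: HBrcd_simps)
  then show ?thesis
    using symmetric_monoidal_category_HBrcd by (simp add: HBrcd_simps bracoid_tensor_def)
qed

end
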